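(* Let $(A,d_A)$ be a differential algebra of weight $\lambda$ over $\mathbf{k}$. The functors $$\ker:(\mathsf{DA}_\lambda/A)_{\mathbf{m}}\to (A,d_A)\text{-}\mathsf{Bimod},\qquad \ltimes:(A,d_A)\text{-}\mathsf{Bimod}\to(\mathsf{DA}_\lambda/A)_{\mathbf{m}}$$ induce an equivalence of categories between the category $(\mathsf{DA}_\lambda/A)_{\mathbf{m}}$ of monoid objects in the slice category $\mathsf{DA}_\lambda/A$ and the category $(A,d_A)\text{-}\mathsf{Bimod}$ of bimodules over $(A,d_A)$.
   Context: Throughout, $\mathbf{k}$ is a field of characteristic zero; all vector spaces, algebras and linear maps are over $\mathbf{k}$. Fix $\lambda\in\mathbf{k}$. A differential algebra of weight $\lambda$ is an associative algebra $A$ (not necessarily unital) with a linear operator $d_A:A\to A$ such that $d_A(xy)=d_A(x)y+xd_A(y)+\lambda d_A(x)d_A(y)$ for all $x,y\in A$; if $A$ is unital one further requires $d_A(1_A)=0$. A homomorphism $(A,d_A)\to(B,d_B)$ is an algebra homomorphism $\varphi$ with $\varphi\circ d_A=d_B\circ\varphi$. The category of differential algebras of weight $\lambda$ is denoted $\mathsf{DA}_\lambda$. A bimodule over an associative algebra $A$ is a vector space $V$ with linear maps $\rho_l:A\to\mathrm{End}_{\mathbf{k}}(V)$, $x\mapsto(v\mapsto xv)$, an algebra homomorphism, and $\rho_r:A\to\mathrm{End}_{\mathbf{k}}(V)$, $x\mapsto(v\mapsto vx)$, an algebra anti-homomorphism, with $(xv)y=x(vy)$. A bimodule over $(A,d_A)$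 is a quadruple $(V,\rho_l,\rho_r,d_V)$ with $(V,\rho_l,\rho_r)$ a bimodule over the associative algebra $A$ and $d_V\in\mathrm{End}_{\mathbf{k}}(V)$ such that $d_V(xv)=d_A(x)v+xd_V(v)+\lambda d_A(x)d_V(v)$ and $d_V(vx)=vd_A(x)+d_V(v)x+\lambda d_V(v)d_A(x)$ for all $x\in A,v\in V$. A homomorphism of bimodules is a linear map commuting with the left and right actions and with the operators $d$. This gives the category $(A,d_A)\text{-}\mathsf{Bimod}$. For a category $\mathcal{C}$ and an object $A$, the slice category $\mathcal{C}/A$ has as objects the morphisms $\pi:B\to A$ in $\mathcal{C}$ and as morphisms from $\pi':B'\to A$ to $\pi'':B''\to A$ the morphisms $f:B'\to B''$ with $\pi''\circ f=\pi'$. In a category $\mathcal{C}$ with finite products and terminal object $T$, a monoid object is an object $X$ with morphisms $\mu:X\times X\to X$ and $\eta:T\to X$ such that $\mu\circ(\mu\times\mathrm{Id}_X)=\mu\circ(\mathrm{Id}_X\times\mu)$ and $\mu\circ(\mathrm{Id}_X\times\eta)\circ(\mathrm{Id}_X,t_X)=\mathrm{Id}_X=\mu\circ(\eta\times\mathrm{Id}_X)\circ(t_X,\mathrm{Id}_X)$, where $t_X:X\to T$ is the unique morphism. $\mathcal{C}_{\mathbf{m}}$ denotes the category of monoid objects of $\mathcal{C}$, with morphisms $(X,\mu,\eta)\to(X',\mu',\eta')$ the $f\in\mathrm{Hom}_{\mathcal{C}}(X,X')$ with $\mu'\circ(f\times f)=f\circ\mu$ and $\eta'=f\circ\eta$.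 In $\mathsf{DA}_\lambda/A$ the terminal object is $\mathrm{Id}:A\to A$, and the product of $\varphi_1:A_1\to A$ and $\varphi_2:A_2\to A$ is $A_1\times_AA_2=\{(a,a')\in A_1\times A_2\mid\varphi_1(a)=\varphi_2(a')\}$ with the map $(a,a')\mapsto\varphi_1(a)$. Thus a monoid object is $\varphi:A'\to A$ together with homomorphisms $M:A'\times_AA'\to A'$ (multiplication) and $\iota:A\to A'$ (unit) over $A$ satisfying the monoid axioms. The functor $\ker$ sends $(\varphi:A'\to A,M,\iota)$, with $d'$ the operator of $A'$, to $V=\ker\varphi$ with $d_V=d'|_V$ and actions $xv:=\iota(x)v$, $vx:=v\iota(x)$ ($x\in A$, $v\in V$). The functor $\ltimes$ sends a bimodule $(V,d_V)$ to the projection $p:A\ltimes V\to A$, where $A\ltimes V=A\oplus V$ with product $(x,u)(y,v)=(xy,xv+uy)$ and operator $(x,u)\mapsto(d_A(x),d_V(u))$, equipped with $M_\ltimes((x,u),(x,v))=(x,u+v)$ and $i_\ltimes(x)=(x,0)$. On morphisms, $\ker$ is restriction to kernels and $\ltimes$ sends $f$ to $(x,u)\mapsto(x,f(u))$. *)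

theory Defs
  imports "HOL-Algebra.Module" "HOL-Library.FuncSet"
begin

section \<open>Categories, functors, equivalences\<close>

text \<open>Morphisms do not carry their domain and codomain: composition and identities take
  the objects involved as arguments, and \<open>Cmp C X Y Z g f\<close> is \<open>g \<circ> f\<close> for
  \<open>f : X \<rightarrow> Y\<close>, \<open>g : Y \<rightarrow> Z\<close>.\<close>

record ('o, 'm) cat =
  Ob  :: "'o set"
  Mor :: "'o \<Rightarrow> 'o \<Rightarrow> 'm set"
  Idm :: "'o \<Rightarrow> 'm"
  Cmp :: "'o \<Rightarrow> 'o \<Rightarrow> 'o \<Rightarrow> 'm \<Rightarrow> 'm \<Rightarrow> 'm"

locale category =
  fixes C :: "('o, 'm) cat"
  assumes Idm_in: "X \<in> Ob C \<Longrightarrow> Idm C X \<in> Mor C X X"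
    and Cmp_in: "\<lbrakk>X \<in> Ob C; Y \<in> Ob C; Z \<in> Ob C; f \<in> Mor C X Y; g \<in> Mor C Y Z\<rbrakk>
      \<Longrightarrow> Cmp C X Y Z g f \<in> Mor C X Z"
    and Cmp_Idm: "\<lbrakk>X \<in> Ob C; Y \<in> Ob C; f \<in> Mor C X Y\<rbrakk> \<Longrightarrow> Cmp C X X Y f (Idm C X) = f"
    and Idm_Cmp: "\<lbrakk>X \<in> Ob C; Y \<in> Ob C; f \<in> Mor C X Y\<rbrakk> \<Longrightarrow> Cmp C X Y Y (Idm C Y) f = f"
    and Cmp_assoc: "\<lbrakk>W \<in> Ob C; X \<in> Ob C; Y \<in> Ob C; Z \<in> Ob C;
        f \<in> Mor C W X; g \<in> Mor C X Y; h \<in> Mor C Y Z\<rbrakk>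
      \<Longrightarrow> Cmp C W X Z (Cmp C X Y Z h g) f = Cmp C W Y Z h (Cmp C W X Y g f)"

record ('o1, 'm1, 'o2, 'm2) func =
  FOb  :: "'o1 \<Rightarrow> 'o2"
  FMor :: "'o1 \<Rightarrow> 'o1 \<Rightarrow> 'm1 \<Rightarrow> 'm2"

locale is_functor = dom: category C + cod: category D
  for C :: "('o1, 'm1) cat" and D :: "('o2, 'm2) cat" +
  fixes F :: "('o1, 'm1, 'o2, 'm2) func"
  assumes FOb_in: "X \<in> Ob C \<Longrightarrow> FOb F X \<in> Ob D"
    and FMor_in: "\<lbrakk>X \<in> Ob C; Y \<in> Ob C; f \<in> Mor C X Y\<rbrakk>
      \<Longrightarrow> FMor F X Y f \<in> Mor D (FOb F X) (FOb F Y)"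
    and FMor_Idm: "X \<in> Ob C \<Longrightarrow> FMor F X X (Idm C X) = Idm D (FOb F X)"
    and FMor_Cmp: "\<lbrakk>X \<in> Ob C; Y \<in> Ob C; Z \<in> Ob C; f \<in> Mor C X Y; g \<in> Mor C Y Z\<rbrakk>
      \<Longrightarrow> FMor F X Z (Cmp C X Y Z g f) =
          Cmp D (FOb F X) (FOb F Y) (FOb F Z) (FMor F Y Z g) (FMor F X Y f)"

definition id_func :: "('o, 'm, 'o, 'm) func" where
  "id_func = \<lparr>FOb = (\<lambda>X. X), FMor = (\<lambda>X Y f. f)\<rparr>"

definition comp_func ::
    "('o2, 'm2, 'o3, 'm3) func \<Rightarrow> ('o1, 'm1, 'o2, 'm2) func \<Rightarrow> ('o1, 'm1, 'o3, 'm3) func" where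
  "comp_func G F = \<lparr>FOb = (\<lambda>X. FOb G (FOb F X)),
     FMor = (\<lambda>X Y f. FMor G (FOb F X) (FOb F Y) (FMor F X Y f))\<rparr>"

definition is_iso :: "('o, 'm) cat \<Rightarrow> 'o \<Rightarrow> 'o \<Rightarrow> 'm \<Rightarrow> bool" where
  "is_iso C X Y f \<longleftrightarrow> f \<in> Mor C X Y \<and>
     (\<exists>g \<in> Mor C Y X. Cmp C X Y X g f = Idm C X \<and> Cmp C Y X Y f g = Idm C Y)"

definition natural_iso :: "('o1, 'm1) cat \<Rightarrow> ('o2, 'm2) cat \<Rightarrow>
    ('o1, 'm1, 'o2, 'm2) func \<Rightarrow> ('o1, 'm1, 'o2, 'm2) func \<Rightarrow> ('o1 \<Rightarrow> 'm2) \<Rightarrow> bool" where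
  "natural_iso C D F G \<tau> \<longleftrightarrow>
     (\<forall>X \<in> Ob C. is_iso D (FOb F X) (FOb G X) (\<tau> X)) \<and>
     (\<forall>X \<in> Ob C. \<forall>Y \<in> Ob C. \<forall>f \<in> Mor C X Y.
        Cmp D (FOb F X) (FOb F Y) (FOb G Y) (\<tau> Y) (FMor F X Y f) =
        Cmp D (FOb F X) (FOb G X) (FOb G Y) (FMor G X Y f) (\<tau> X))"

definition equivalence_of_categories :: "('o1, 'm1) cat \<Rightarrow> ('o2, 'm2) cat \<Rightarrow>
    ('o1, 'm1, 'o2, 'm2) func \<Rightarrow> ('o2, 'm2, 'o1, 'm1) func \<Rightarrow> bool" where
  "equivalence_of_categories C D F G \<longleftrightarrow>
     is_functor C D F \<and> is_functor D C G \<and>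
     (\<exists>\<eta>. natural_iso C C id_func (comp_func G F) \<eta>) \<and>
     (\<exists>\<epsilon>. natural_iso D D (comp_func F G) id_func \<epsilon>)"


section \<open>Slice categories and monoid objects\<close>

definition slice :: "('o, 'm) cat \<Rightarrow> 'o \<Rightarrow> ('o \<times> 'm, 'm) cat" where
  "slice C A = \<lparr>
     Ob  = {(B, \<pi>). B \<in> Ob C \<and> \<pi> \<in> Mor C B A},
     Mor = (\<lambda>(B, \<pi>) (B', \<pi>'). {f \<in> Mor C B B'. Cmp C B B' A \<pi>' f = \<pi>}),
     Idm = (\<lambda>(B, \<pi>). Idm C B),
     Cmp = (\<lambda>(B, \<pi>) (B', \<pi>') (B'', \<pi>'') g f. Cmp C B B' B'' g f)\<rparr>"

definition is_terminal :: "('o, 'm) cat \<Rightarrow> 'o \<Rightarrow> bool" where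
  "is_terminal C T \<longleftrightarrow> T \<in> Ob C \<and> (\<forall>X \<in> Ob C. \<exists>!t. t \<in> Mor C X T)"

definition is_product :: "('o, 'm) cat \<Rightarrow> 'o \<Rightarrow> 'o \<Rightarrow> 'o \<Rightarrow> 'm \<Rightarrow> 'm \<Rightarrow> bool" where
  "is_product C X Y P p q \<longleftrightarrow>
     X \<in> Ob C \<and> Y \<in> Ob C \<and> P \<in> Ob C \<and> p \<in> Mor C P X \<and> q \<in> Mor C P Y \<and>
     (\<forall>Z \<in> Ob C. \<forall>f \<in> Mor C Z X. \<forall>g \<in> Mor C Z Y.
        \<exists>!h. h \<in> Mor C Z P \<and> Cmp C Z P X p h = f \<and> Cmp C Z P Y q h = g)"

text \<open>A choice of terminal object and of binary product cones.\<close>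

record ('o, 'm) products =
  Term :: "'o"
  Prod :: "'o \<Rightarrow> 'o \<Rightarrow> 'o"
  Prj1 :: "'o \<Rightarrow> 'o \<Rightarrow> 'm"
  Prj2 :: "'o \<Rightarrow> 'o \<Rightarrow> 'm"

definition to_term :: "('o, 'm) cat \<Rightarrow> ('o, 'm) products \<Rightarrow> 'o \<Rightarrow> 'm" where
  "to_term C S X = (THE t. t \<in> Mor C X (Term S))"

text \<open>\<open>pairing C S Z X Y f g\<close> is \<open>(f, g) : Z \<rightarrow> X \<times> Y\<close>, and
  \<open>times C S X Y X' Y' f g\<close> is \<open>f \<times> g : X \<times> Y \<rightarrow> X' \<times> Y'\<close>.\<close>

definition pairing ::
    "('o, 'm) cat \<Rightarrow> ('o, 'm) products \<Rightarrow> 'o \<Rightarrow> 'o \<Rightarrow> 'o \<Rightarrow> 'm \<Rightarrow> 'm \<Rightarrow> 'm" where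
  "pairing C S Z X Y f g = (THE h. h \<in> Mor C Z (Prod S X Y) \<and>
     Cmp C Z (Prod S X Y) X (Prj1 S X Y) h = f \<and> Cmp C Z (Prod S X Y) Y (Prj2 S X Y) h = g)"

definition times ::
    "('o, 'm) cat \<Rightarrow> ('o, 'm) products \<Rightarrow> 'o \<Rightarrow> 'o \<Rightarrow> 'o \<Rightarrow> 'o \<Rightarrow> 'm \<Rightarrow> 'm \<Rightarrow> 'm" where
  "times C S X Y X' Y' f g = pairing C S (Prod S X Y) X' Y'
     (Cmp C (Prod S X Y) X X' f (Prj1 S X Y)) (Cmp C (Prod S X Y) Y Y' g (Prj2 S X Y))"

text \<open>The canonical isomorphism \<open>(X \<times> Y) \<times> Z \<rightarrow> X \<times> (Y \<times> Z)\<close>.\<close>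

definition reassoc :: "('o, 'm) cat \<Rightarrow> ('o, 'm) products \<Rightarrow> 'o \<Rightarrow> 'o \<Rightarrow> 'o \<Rightarrow> 'm" where
  "reassoc C S X Y Z =
    (let XY = Prod S X Y; P = Prod S XY Z in
     pairing C S P X (Prod S Y Z)
       (Cmp C P XY X (Prj1 S X Y) (Prj1 S XY Z))
       (pairing C S P Y Z
          (Cmp C P XY Y (Prj2 S X Y) (Prj1 S XY Z))
          (Prj2 S XY Z)))"

text \<open>The category \<open>C\<close> is not assumed to have all finite products; instead the chosen cones
  occurring in the axioms must be products. (In a category with finite products, \<open>S\<close> being a
  choice of these, the first two assumptions hold for every object.) This matters for the slice
  category below: because of the clause on unital algebras in the definition of a differential
  algebra, a fibre product of differential algebras can fail to be one. If \<open>\<lambda> \<noteq> 0\<close>, let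
  \<open>N \<noteq> 0\<close> have zero product and zero operator, and let \<open>k e\<close> be spanned by an idempotent \<open>e\<close>
  with \<open>d e = - \<lambda>\<^sup>-\<^sup>1 e\<close>; then \<open>k e \<times> N\<close> is not unital, but its fibre product with \<open>0\<close>
  over \<open>N\<close> is \<open>k e\<close>. If \<open>B \<rightarrow> A\<close> carries a multiplication and a unit satisfying the unit
  axioms, then \<open>B\<close> is a square-zero extension of \<open>A\<close> and the fibre powers of \<open>B\<close> over \<open>A\<close>
  are differential algebras, so no monoid is lost.\<close>

locale monoid_object =
  fixes C :: "('o, 'm) cat" and S :: "('o, 'm) products"
    and X :: 'o and \<mu> :: 'm and \<eta> :: 'm
  assumes terminal: "is_terminal C (Term S)"
    and products: "(Y, Z) \<in> {(X, X), (Prod S X X, X), (X, Prod S X X), (X, Term S), (Term S, X)}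
      \<Longrightarrow> is_product C Y Z (Prod S Y Z) (Prj1 S Y Z) (Prj2 S Y Z)"
    and X_in: "X \<in> Ob C"
    and mult_in: "\<mu> \<in> Mor C (Prod S X X) X"
    and unit_in: "\<eta> \<in> Mor C (Term S) X"
    and mult_assoc:
      "Cmp C (Prod S (Prod S X X) X) (Prod S X X) X \<mu> (times C S (Prod S X X) X X X \<mu> (Idm C X)) =
       Cmp C (Prod S (Prod S X X) X) (Prod S X X) X \<mu>
         (Cmp C (Prod S (Prod S X X) X) (Prod S X (Prod S X X)) (Prod S X X)
            (times C S X (Prod S X X) X X (Idm C X) \<mu>) (reassoc C S X X X))"
    and mult_unit:
      "Cmp C X (Prod S X X) X \<mu>
         (Cmp C X (Prod S X (Term S)) (Prod S X X)
            (times C S X (Term S) X X (Idm C X) \<eta>)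
            (pairing C S X X (Term S) (Idm C X) (to_term C S X))) = Idm C X"
    and unit_mult:
      "Cmp C X (Prod S X X) X \<mu>
         (Cmp C X (Prod S (Term S) X) (Prod S X X)
            (times C S (Term S) X X X \<eta> (Idm C X))
            (pairing C S X (Term S) X (to_term C S X) (Idm C X))) = Idm C X"

definition monoids :: "('o, 'm) cat \<Rightarrow> ('o, 'm) products \<Rightarrow> ('o \<times> 'm \<times> 'm, 'm) cat" where
  "monoids C S = \<lparr>
     Ob  = {(X, \<mu>, \<eta>). monoid_object C S X \<mu> \<eta>},
     Mor = (\<lambda>(X, \<mu>, \<eta>) (X', \<mu>', \<eta>'). {f \<in> Mor C X X'.
       Cmp C (Prod S X X) (Prod S X' X') X' \<mu>' (times C S X X X' X' f f) =
         Cmp C (Prod S X X) X X' f \<mu> \<and>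
       \<eta>' = Cmp C (Term S) X X' f \<eta>}),
     Idm = (\<lambda>(X, \<mu>, \<eta>). Idm C X),
     Cmp = (\<lambda>(X, \<mu>, \<eta>) (X', \<mu>', \<eta>') (X'', \<mu>'', \<eta>'') g f. Cmp C X X' X'' g f)\<rparr>"


section \<open>Differential algebras of weight \<open>\<lambda>\<close> and their bimodules\<close>

text \<open>Vector spaces are modules, in the sense of HOL-Algebra, over a field \<open>K\<close>.
  The record type of modules extends that of rings: the component \<open>one\<close> of an algebra, and the
  components \<open>mult\<close> and \<open>one\<close> of a bimodule, carry no meaning and are not constrained.\<close>

record ('k, 'u) dalg = "('k, 'u) module" +
  der :: "'u \<Rightarrow> 'u"

record ('k, 'u) dbimod = "('k, 'u) module" +
  lact :: "'u \<Rightarrow> 'u \<Rightarrow> 'u"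
  ract :: "'u \<Rightarrow> 'u \<Rightarrow> 'u"
  bder :: "'u \<Rightarrow> 'u"

definition linear_on ::
    "('k, 'r) ring_scheme \<Rightarrow> ('k, 'u, 's) module_scheme \<Rightarrow> ('k, 'v, 't) module_scheme \<Rightarrow>
     ('u \<Rightarrow> 'v) \<Rightarrow> bool" where
  "linear_on K V W f \<longleftrightarrow> f \<in> carrier V \<rightarrow> carrier W \<and>
     (\<forall>x \<in> carrier V. \<forall>y \<in> carrier V. f (x \<oplus>\<^bsub>V\<^esub> y) = f x \<oplus>\<^bsub>W\<^esub> f y) \<and>
     (\<forall>c \<in> carrier K. \<forall>x \<in> carrier V. f (c \<odot>\<^bsub>V\<^esub> x) = c \<odot>\<^bsub>W\<^esub> f x)"

locale diff_algebra = module K A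
  for K :: "('k, 'r) ring_scheme" and lam :: 'k and A :: "('k, 'u) dalg" +
  assumes mult_linear_right: "x \<in> carrier A \<Longrightarrow> linear_on K A A (\<lambda>y. x \<otimes>\<^bsub>A\<^esub> y)"
    and mult_linear_left: "y \<in> carrier A \<Longrightarrow> linear_on K A A (\<lambda>x. x \<otimes>\<^bsub>A\<^esub> y)"
    and mult_assoc: "\<lbrakk>x \<in> carrier A; y \<in> carrier A; z \<in> carrier A\<rbrakk>
      \<Longrightarrow> (x \<otimes>\<^bsub>A\<^esub> y) \<otimes>\<^bsub>A\<^esub> z = x \<otimes>\<^bsub>A\<^esub> (y \<otimes>\<^bsub>A\<^esub> z)"
    and der_linear: "linear_on K A A (der A)"
    and der_mult: "\<lbrakk>x \<in> carrier A; y \<in> carrier A\<rbrakk> \<Longrightarrow>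
      der A (x \<otimes>\<^bsub>A\<^esub> y) =
        der A x \<otimes>\<^bsub>A\<^esub> y \<oplus>\<^bsub>A\<^esub> x \<otimes>\<^bsub>A\<^esub> der A y \<oplus>\<^bsub>A\<^esub> lam \<odot>\<^bsub>A\<^esub> (der A x \<otimes>\<^bsub>A\<^esub> der A y)"
    and der_unit: "\<lbrakk>e \<in> carrier A; \<And>x. x \<in> carrier A \<Longrightarrow> e \<otimes>\<^bsub>A\<^esub> x = x \<and> x \<otimes>\<^bsub>A\<^esub> e = x\<rbrakk>
      \<Longrightarrow> der A e = \<zero>\<^bsub>A\<^esub>"

text \<open>Homomorphisms are extensional functions, so that two of them are equal if they agree on
  the carrier. They need not preserve units.\<close>

locale diff_algebra_hom = dom: diff_algebra K lam A + cod: diff_algebra K lam B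
  for K :: "('k, 'r) ring_scheme" and lam :: 'k and A B :: "('k, 'u) dalg" +
  fixes f :: "'u \<Rightarrow> 'u"
  assumes ext: "f \<in> extensional (carrier A)"
    and linear: "linear_on K A B f"
    and mult: "\<lbrakk>x \<in> carrier A; y \<in> carrier A\<rbrakk> \<Longrightarrow> f (x \<otimes>\<^bsub>A\<^esub> y) = f x \<otimes>\<^bsub>B\<^esub> f y"
    and der: "x \<in> carrier A \<Longrightarrow> f (der A x) = der B (f x)"

definition DA :: "('k, 'r) ring_scheme \<Rightarrow> 'k \<Rightarrow> (('k, 'u) dalg, 'u \<Rightarrow> 'u) cat" where
  "DA K lam = \<lparr>
     Ob  = {A. diff_algebra K lam A},
     Mor = (\<lambda>A B. {f. diff_algebra_hom K lam A B f}),
     Idm = (\<lambda>A. \<lambda>x\<in>carrier A. x),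
     Cmp = (\<lambda>A B C g f. compose (carrier A) g f)\<rparr>"

locale diff_bimodule = alg: diff_algebra K lam A + V: module K V
  for K :: "('k, 'r) ring_scheme" and lam :: 'k
    and A :: "('k, 'u) dalg" and V :: "('k, 'u) dbimod" +
  assumes lact_linear: "x \<in> carrier A \<Longrightarrow> linear_on K V V (\<lambda>v. lact V x v)"
    and lact_linear': "v \<in> carrier V \<Longrightarrow> linear_on K A V (\<lambda>x. lact V x v)"
    and ract_linear: "x \<in> carrier A \<Longrightarrow> linear_on K V V (\<lambda>v. ract V v x)"
    and ract_linear': "v \<in> carrier V \<Longrightarrow> linear_on K A V (\<lambda>x. ract V v x)"
    and lact_mult: "\<lbrakk>x \<in> carrier A; y \<in> carrier A; v \<in> carrier V\<rbrakk>
      \<Longrightarrow> lact V (x \<otimes>\<^bsub>A\<^esub> y) v = lact V x (lact V y v)"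
    and ract_mult: "\<lbrakk>x \<in> carrier A; y \<in> carrier A; v \<in> carrier V\<rbrakk>
      \<Longrightarrow> ract V v (x \<otimes>\<^bsub>A\<^esub> y) = ract V (ract V v x) y"
    and lact_ract: "\<lbrakk>x \<in> carrier A; y \<in> carrier A; v \<in> carrier V\<rbrakk>
      \<Longrightarrow> ract V (lact V x v) y = lact V x (ract V v y)"
    and bder_linear: "linear_on K V V (bder V)"
    and bder_lact: "\<lbrakk>x \<in> carrier A; v \<in> carrier V\<rbrakk> \<Longrightarrow>
      bder V (lact V x v) =
        lact V (der A x) v \<oplus>\<^bsub>V\<^esub> lact V x (bder V v) \<oplus>\<^bsub>V\<^esub> lam \<odot>\<^bsub>V\<^esub> lact V (der A x) (bder V v)"
    and bder_ract: "\<lbrakk>x \<in> carrier A; v \<in> carrier V\<rbrakk> \<Longrightarrow>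
      bder V (ract V v x) =
        ract V v (der A x) \<oplus>\<^bsub>V\<^esub> ract V (bder V v) x \<oplus>\<^bsub>V\<^esub> lam \<odot>\<^bsub>V\<^esub> ract V (bder V v) (der A x)"

locale diff_bimodule_hom = dom: diff_bimodule K lam A V + cod: diff_bimodule K lam A W
  for K :: "('k, 'r) ring_scheme" and lam :: 'k
    and A :: "('k, 'u) dalg" and V W :: "('k, 'u) dbimod" +
  fixes f :: "'u \<Rightarrow> 'u"
  assumes ext: "f \<in> extensional (carrier V)"
    and linear: "linear_on K V W f"
    and lact: "\<lbrakk>x \<in> carrier A; v \<in> carrier V\<rbrakk> \<Longrightarrow> f (lact V x v) = lact W x (f v)"
    and ract: "\<lbrakk>x \<in> carrier A; v \<in> carrier V\<rbrakk> \<Longrightarrow> f (ract V v x) = ract W (f v) x"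
    and bder: "v \<in> carrier V \<Longrightarrow> f (bder V v) = bder W (f v)"

definition Bimod ::
    "('k, 'r) ring_scheme \<Rightarrow> 'k \<Rightarrow> ('k, 'u) dalg \<Rightarrow> (('k, 'u) dbimod, 'u \<Rightarrow> 'u) cat" where
  "Bimod K lam A = \<lparr>
     Ob  = {V. diff_bimodule K lam A V},
     Mor = (\<lambda>V W. {f. diff_bimodule_hom K lam A V W f}),
     Idm = (\<lambda>V. \<lambda>v\<in>carrier V. v),
     Cmp = (\<lambda>U V W g f. compose (carrier U) g f)\<rparr>"


section \<open>Fibre products\<close>

text \<open>The carriers of all objects are subsets of a type \<open>'u\<close>, which plays the role of a
  universe. It is closed under binary products by means of an injection
  \<open>pr :: 'u \<times> 'u \<Rightarrow> 'u\<close>, which encodes pairs.\<close>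

definition unpair :: "('u \<times> 'u \<Rightarrow> 'u) \<Rightarrow> 'u \<Rightarrow> 'u \<times> 'u" where
  "unpair pr = inv_into UNIV pr"

lemma unpair_pr [simp]: "inj pr \<Longrightarrow> unpair pr (pr p) = p"
  by (simp add: unpair_def)

definition fibre_product ::
    "('u \<times> 'u \<Rightarrow> 'u) \<Rightarrow> ('k, 'u) dalg \<times> ('u \<Rightarrow> 'u) \<Rightarrow> ('k, 'u) dalg \<times> ('u \<Rightarrow> 'u) \<Rightarrow>
     ('k, 'u) dalg" where
  "fibre_product pr = (\<lambda>(A1, \<phi>1) (A2, \<phi>2). \<lparr>
     carrier = pr ` {(a, a'). a \<in> carrier A1 \<and> a' \<in> carrier A2 \<and> \<phi>1 a = \<phi>2 a'},
     mult = (\<lambda>z w. let (a, a') = unpair pr z; (b, b') = unpair pr w in pr (a \<otimes>\<^bsub>A1\<^esub> b, a' \<otimes>\<^bsub>A2\<^esub> b')),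
     one = pr (\<one>\<^bsub>A1\<^esub>, \<one>\<^bsub>A2\<^esub>),
     zero = pr (\<zero>\<^bsub>A1\<^esub>, \<zero>\<^bsub>A2\<^esub>),
     add = (\<lambda>z w. let (a, a') = unpair pr z; (b, b') = unpair pr w in pr (a \<oplus>\<^bsub>A1\<^esub> b, a' \<oplus>\<^bsub>A2\<^esub> b')),
     smult = (\<lambda>c z. let (a, a') = unpair pr z in pr (c \<odot>\<^bsub>A1\<^esub> a, c \<odot>\<^bsub>A2\<^esub> a')),
     der = (\<lambda>z. let (a, a') = unpair pr z in pr (der A1 a, der A2 a'))\<rparr>)"

definition slice_products ::
    "('u \<times> 'u \<Rightarrow> 'u) \<Rightarrow> ('k, 'u) dalg \<Rightarrow> (('k, 'u) dalg \<times> ('u \<Rightarrow> 'u), 'u \<Rightarrow> 'u) products" where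
  "slice_products pr A = \<lparr>
     Term = (A, \<lambda>x\<in>carrier A. x),
     Prod = (\<lambda>X Y. (fibre_product pr X Y,
        \<lambda>z\<in>carrier (fibre_product pr X Y). snd X (fst (unpair pr z)))),
     Prj1 = (\<lambda>X Y. \<lambda>z\<in>carrier (fibre_product pr X Y). fst (unpair pr z)),
     Prj2 = (\<lambda>X Y. \<lambda>z\<in>carrier (fibre_product pr X Y). snd (unpair pr z))\<rparr>"

text \<open>The chosen cones have the universal properties in the slice category, a fibre product as
  soon as it is a differential algebra.\<close>

lemma slice_terminal:
  assumes "diff_algebra K lam A"
  shows "is_terminal (slice (DA K lam) A) (Term (slice_products pr A))"
proof -
  have id: "diff_algebra_hom K lam A A (\<lambda>x\<in>carrier A. x)"
  proof -
    interpret diff_algebra K lam A by fact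
    have "der A x \<in> carrier A" if "x \<in> carrier A" for x
      using der_linear that by (auto simp: linear_on_def)
    moreover have "x \<otimes>\<^bsub>A\<^esub> y \<in> carrier A" if "x \<in> carrier A" "y \<in> carrier A" for x y
      using mult_linear_right[OF that(1)] that by (auto simp: linear_on_def)
    ultimately show ?thesis
      by unfold_locales (auto simp: linear_on_def)
  qed
  have id_comp: "compose (carrier B) (\<lambda>x\<in>carrier A. x) f = f" if "diff_algebra_hom K lam B A f" for B f
  proof -
    interpret diff_algebra_hom K lam B A f by fact
    show ?thesis using linear ext by (intro Id_compose) (auto simp: linear_on_def)
  qed
  have "\<exists>!t. t \<in> Mor (slice (DA K lam) A) X (A, \<lambda>x\<in>carrier A. x)"
    if "X \<in> Ob (slice (DA K lam) A)" for X
  proof -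
    obtain B \<pi> where X: "X = (B, \<pi>)" by (cases X)
    with that have "diff_algebra_hom K lam B A \<pi>" by (simp add: slice_def DA_def)
    with id_comp X show ?thesis by (auto simp: slice_def DA_def)
  qed
  with assms id show ?thesis
    by (simp add: is_terminal_def slice_products_def) (simp add: slice_def DA_def)
qed

lemma slice_product:
  assumes pr: "inj pr"
    and X: "X \<in> Ob (slice (DA K lam) A)" and Y: "Y \<in> Ob (slice (DA K lam) A)"
    and XY: "diff_algebra K lam (fibre_product pr X Y)"
  shows "is_product (slice (DA K lam) A) X Y (Prod (slice_products pr A) X Y)
    (Prj1 (slice_products pr A) X Y) (Prj2 (slice_products pr A) X Y)"
proof -
  obtain B \<phi> where [simp]: "X = (B, \<phi>)" by (cases X)
  obtain C \<psi> where [simp]: "Y = (C, \<psi>)" by (cases Y)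
  define P where "P = fibre_product pr (B, \<phi>) (C, \<psi>)"
  note up = unpair_pr[OF pr]
  have B: "diff_algebra K lam B" and C: "diff_algebra K lam C" and A: "diff_algebra K lam A"
    and P: "diff_algebra K lam P"
    and \<phi>: "diff_algebra_hom K lam B A \<phi>" and \<psi>: "diff_algebra_hom K lam C A \<psi>"
    using X Y XY by (auto simp: slice_def DA_def P_def diff_algebra_hom_def)
  interpret B: diff_algebra K lam B by fact
  interpret C: diff_algebra K lam C by fact
  interpret P: diff_algebra K lam P by fact
  interpret \<phi>: diff_algebra_hom K lam B A \<phi> by fact
  interpret \<psi>: diff_algebra_hom K lam C A \<psi> by fact
  have Pc: "carrier P = pr ` {(a, a'). a \<in> carrier B \<and> a' \<in> carrier C \<and> \<phi> a = \<psi> a'}"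
    by (simp add: P_def fibre_product_def)
  have PE: thesis if "z \<in> carrier P"
    "\<And>a a'. \<lbrakk>z = pr (a, a'); a \<in> carrier B; a' \<in> carrier C; \<phi> a = \<psi> a'\<rbrakk> \<Longrightarrow> thesis" for z thesis
    using that by (auto simp: Pc)
  have Pi: "pr (a, a') \<in> carrier P" if "a \<in> carrier B" "a' \<in> carrier C" "\<phi> a = \<psi> a'" for a a'
    using that by (auto simp: Pc)
  have Padd: "pr (a, a') \<oplus>\<^bsub>P\<^esub> pr (b, b') = pr (a \<oplus>\<^bsub>B\<^esub> b, a' \<oplus>\<^bsub>C\<^esub> b')" for a a' b b'
    by (simp add: P_def fibre_product_def up)
  have Pmul: "pr (a, a') \<otimes>\<^bsub>P\<^esub> pr (b, b') = pr (a \<otimes>\<^bsub>B\<^esub> b, a' \<otimes>\<^bsub>C\<^esub> b')" for a a' b b'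
    by (simp add: P_def fibre_product_def up)
  have Psm: "c \<odot>\<^bsub>P\<^esub> pr (a, a') = pr (c \<odot>\<^bsub>B\<^esub> a, c \<odot>\<^bsub>C\<^esub> a')" for a a' c
    by (simp add: P_def fibre_product_def up)
  have Pder: "der P (pr (a, a')) = pr (der B a, der C a')" for a a'
    by (simp add: P_def fibre_product_def up)
  have Pcl: "x \<oplus>\<^bsub>P\<^esub> y \<in> carrier P" "x \<otimes>\<^bsub>P\<^esub> y \<in> carrier P" "der P x \<in> carrier P"
    if "x \<in> carrier P" "y \<in> carrier P" for x y
    using that P.mult_linear_right[of x] P.der_linear by (auto simp: linear_on_def)
  define p where "p = (\<lambda>z\<in>carrier P. fst (unpair pr z))"
  define q where "q = (\<lambda>z\<in>carrier P. snd (unpair pr z))"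
  define \<rho> where "\<rho> = (\<lambda>z\<in>carrier P. \<phi> (fst (unpair pr z)))"
  have pv: "p (pr (a, a')) = a" and qv: "q (pr (a, a')) = a'" and \<rho>v: "\<rho> (pr (a, a')) = \<phi> a"
    if "pr (a, a') \<in> carrier P" for a a'
    using that by (simp_all add: p_def q_def \<rho>_def up)
  have Psmc: "c \<odot>\<^bsub>P\<^esub> x \<in> carrier P" if "c \<in> carrier K" "x \<in> carrier P" for c x
    using that by (rule P.smult_closed)
  have p: "diff_algebra_hom K lam P B p"
  proof (unfold_locales, goal_cases)
    case 1 show ?case by (simp add: p_def)
  next
    case 2 show ?case unfolding linear_on_def
    proof (intro conjI ballI)
      show "p \<in> carrier P \<rightarrow> carrier B" by (auto elim!: PE simp: Pi pv)
      show "p (x \<oplus>\<^bsub>P\<^esub> y) = p x \<oplus>\<^bsub>B\<^esub> p y" if "x \<in> carrier P" "y \<in> carrier P" for x y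
        using that by (simp add: p_def Pcl) (auto elim!: PE simp: Padd up)
      show "p (c \<odot>\<^bsub>P\<^esub> x) = c \<odot>\<^bsub>B\<^esub> p x" if "c \<in> carrier K" "x \<in> carrier P" for c x
        using that by (simp add: p_def Psmc) (auto elim!: PE simp: Psm up)
    qed
  next
    case (3 x y) then show ?case by (simp add: p_def Pcl) (auto elim!: PE simp: Pmul up)
  next
    case (4 x) then show ?case by (simp add: p_def Pcl) (auto elim!: PE simp: Pder up)
  qed
  have q: "diff_algebra_hom K lam P C q"
  proof (unfold_locales, goal_cases)
    case 1 show ?case by (simp add: q_def)
  next
    case 2 show ?case unfolding linear_on_def
    proof (intro conjI ballI)
      show "q \<in> carrier P \<rightarrow> carrier C" by (auto elim!: PE simp: Pi qv)
      show "q (x \<oplus>\<^bsub>P\<^esub> y) = q x \<oplus>\<^bsub>C\<^esub> q y" if "x \<in> carrier P" "y \<in> carrier P" for x y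
        using that by (simp add: q_def Pcl) (auto elim!: PE simp: Padd up)
      show "q (c \<odot>\<^bsub>P\<^esub> x) = c \<odot>\<^bsub>C\<^esub> q x" if "c \<in> carrier K" "x \<in> carrier P" for c x
        using that by (simp add: q_def Psmc) (auto elim!: PE simp: Psm up)
    qed
  next
    case (3 x y) then show ?case by (simp add: q_def Pcl) (auto elim!: PE simp: Pmul up)
  next
    case (4 x) then show ?case by (simp add: q_def Pcl) (auto elim!: PE simp: Pder up)
  qed
  have \<phi>p: "compose (carrier P) \<phi> p = \<rho>" and \<psi>q: "compose (carrier P) \<psi> q = \<rho>"
    by (auto simp: compose_def \<rho>_def p_def q_def up fun_eq_iff elim!: PE)
  have BA: "\<phi> \<in> carrier B \<rightarrow> carrier A" using \<phi>.linear by (simp add: linear_on_def)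
  have \<rho>: "diff_algebra_hom K lam P A \<rho>"
  proof -
    interpret p: diff_algebra_hom K lam P B p by fact
    have pB: "p \<in> carrier P \<rightarrow> carrier B" using p.linear by (simp add: linear_on_def)
    show ?thesis unfolding \<phi>p[symmetric]
    proof (unfold_locales, goal_cases)
      case 2 show ?case using p.linear \<phi>.linear Pcl Psmc
        by (auto simp: linear_on_def compose_def Pi_iff)
    qed (use pB Pcl in \<open>auto simp: compose_def p.mult \<phi>.mult p.der \<phi>.der Pi_iff\<close>)
  qed
  have ex: "\<exists>!h. h \<in> Mor (slice (DA K lam) A) Z (P, \<rho>) \<and>
      Cmp (slice (DA K lam) A) Z (P, \<rho>) X p h = f \<and> Cmp (slice (DA K lam) A) Z (P, \<rho>) Y q h = g"
    if Z: "Z \<in> Ob (slice (DA K lam) A)" and f: "f \<in> Mor (slice (DA K lam) A) Z X"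
      and g: "g \<in> Mor (slice (DA K lam) A) Z Y" for Z f g
  proof -
    obtain D \<chi> where [simp]: "Z = (D, \<chi>)" by (cases Z)
    have f: "diff_algebra_hom K lam D B f" "compose (carrier D) \<phi> f = \<chi>"
      and g: "diff_algebra_hom K lam D C g" "compose (carrier D) \<psi> g = \<chi>"
      using f g by (auto simp: slice_def DA_def)
    interpret f: diff_algebra_hom K lam D B f by fact
    interpret g: diff_algebra_hom K lam D C g by fact
    have fB: "f x \<in> carrier B" and gC: "g x \<in> carrier C" and fg: "\<phi> (f x) = \<psi> (g x)"
      if "x \<in> carrier D" for x
      using that f.linear g.linear fun_cong[OF f(2), of x] fun_cong[OF g(2), of x]
      by (auto simp: linear_on_def compose_def)
    define h where "h = (\<lambda>x\<in>carrier D. pr (f x, g x))"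
    have Dcl: "x \<otimes>\<^bsub>D\<^esub> y \<in> carrier D" "der D x \<in> carrier D"
      if "x \<in> carrier D" "y \<in> carrier D" for x y
      using that f.dom.mult_linear_right[of x] f.dom.der_linear by (auto simp: linear_on_def)
    have h: "diff_algebra_hom K lam D P h"
    proof (unfold_locales, goal_cases)
      case 1 show ?case by (simp add: h_def)
    next
      case 2 show ?case using f.linear g.linear fg
        by (auto simp: linear_on_def h_def Padd Psm intro!: Pi)
    qed (auto simp: h_def Dcl f.mult g.mult f.der g.der Pmul Pder)
    have ph: "compose (carrier D) p h = f" and qh: "compose (carrier D) q h = g"
      and \<rho>h: "compose (carrier D) \<rho> h = \<chi>"
      using f.ext g.ext
      by (auto simp: fun_eq_iff compose_def h_def pv qv \<rho>v Pi fB gC fg extensional_def f(2)[symmetric])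
    have uniq: "h' = h" if "diff_algebra_hom K lam D P h'"
      "compose (carrier D) p h' = f" "compose (carrier D) q h' = g" for h'
    proof -
      interpret h': diff_algebra_hom K lam D P h' by fact
      show ?thesis
      proof
        fix x show "h' x = h x"
        proof (cases "x \<in> carrier D")
          case True
          then have "h' x \<in> carrier P" using h'.linear by (auto simp: linear_on_def)
          then show ?thesis using True that(2,3)
            by (auto elim!: PE simp: h_def compose_def pv qv Pi)
        next
          case False
          then show ?thesis using h'.ext by (simp add: h_def extensional_def)
        qed
      qed
    qed
    show ?thesis
    proof (rule ex1I[of _ h], goal_cases)
      case 1 show ?case using h ph qh \<rho>h by (simp add: slice_def DA_def)
    next
      case (2 h') show ?case by (rule uniq) (use 2 in \<open>simp_all add: slice_def DA_def\<close>)
    qed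
  qed
  have S: "Prod (slice_products pr A) X Y = (P, \<rho>)" "Prj1 (slice_products pr A) X Y = p"
    "Prj2 (slice_products pr A) X Y = q"
    by (simp_all add: slice_products_def P_def p_def q_def \<rho>_def)
  show ?thesis
    unfolding is_product_def S
    using X Y ex p q \<rho> P \<phi>p \<psi>q by (auto simp: slice_def DA_def)
qed


section \<open>The functors\<close>

text \<open>An object of \<open>monoids (slice (DA K lam) A) (slice_products pr A)\<close> is a tuple
  \<open>((B, \<phi>), M, i)\<close>.\<close>

type_synonym ('k, 'u) slice_monoid = "(('k, 'u) dalg \<times> ('u \<Rightarrow> 'u)) \<times> ('u \<Rightarrow> 'u) \<times> ('u \<Rightarrow> 'u)"

definition ker_bimod :: "('k, 'u) dalg \<Rightarrow> ('k, 'u) slice_monoid \<Rightarrow> ('k, 'u) dbimod" where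
  "ker_bimod A = (\<lambda>((B, \<phi>), M, i). \<lparr>
     carrier = {v \<in> carrier B. \<phi> v = \<zero>\<^bsub>A\<^esub>},
     mult = mult B, one = one B, zero = zero B, add = add B, smult = smult B,
     lact = (\<lambda>x v. i x \<otimes>\<^bsub>B\<^esub> v),
     ract = (\<lambda>v x. v \<otimes>\<^bsub>B\<^esub> i x),
     bder = der B\<rparr>)"

definition ker_func ::
    "('k, 'u) dalg \<Rightarrow> (('k, 'u) slice_monoid, 'u \<Rightarrow> 'u, ('k, 'u) dbimod, 'u \<Rightarrow> 'u) func" where
  "ker_func A = \<lparr>
     FOb = ker_bimod A,
     FMor = (\<lambda>X Y f. restrict f (carrier (ker_bimod A X)))\<rparr>"

definition semidirect ::
    "('u \<times> 'u \<Rightarrow> 'u) \<Rightarrow> ('k, 'u) dalg \<Rightarrow> ('k, 'u) dbimod \<Rightarrow> ('k, 'u) dalg" where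
  "semidirect pr A V = \<lparr>
     carrier = pr ` (carrier A \<times> carrier V),
     mult = (\<lambda>z w. let (x, u) = unpair pr z; (y, v) = unpair pr w in
               pr (x \<otimes>\<^bsub>A\<^esub> y, lact V x v \<oplus>\<^bsub>V\<^esub> ract V u y)),
     one = pr (\<one>\<^bsub>A\<^esub>, \<zero>\<^bsub>V\<^esub>),
     zero = pr (\<zero>\<^bsub>A\<^esub>, \<zero>\<^bsub>V\<^esub>),
     add = (\<lambda>z w. let (x, u) = unpair pr z; (y, v) = unpair pr w in pr (x \<oplus>\<^bsub>A\<^esub> y, u \<oplus>\<^bsub>V\<^esub> v)),
     smult = (\<lambda>c z. let (x, u) = unpair pr z in pr (c \<odot>\<^bsub>A\<^esub> x, c \<odot>\<^bsub>V\<^esub> u)),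
     der = (\<lambda>z. let (x, u) = unpair pr z in pr (der A x, bder V u))\<rparr>"

definition semidirect_over ::
    "('u \<times> 'u \<Rightarrow> 'u) \<Rightarrow> ('k, 'u) dalg \<Rightarrow> ('k, 'u) dbimod \<Rightarrow> ('k, 'u) dalg \<times> ('u \<Rightarrow> 'u)" where
  "semidirect_over pr A V =
     (semidirect pr A V, \<lambda>z\<in>carrier (semidirect pr A V). fst (unpair pr z))"

definition semidirect_monoid ::
    "('u \<times> 'u \<Rightarrow> 'u) \<Rightarrow> ('k, 'u) dalg \<Rightarrow> ('k, 'u) dbimod \<Rightarrow> ('k, 'u) slice_monoid" where
  "semidirect_monoid pr A V =
     (let X = semidirect_over pr A V in
      (X,
       \<lambda>z\<in>carrier (fibre_product pr X X).
         let (a, b) = unpair pr z; (x, u) = unpair pr a; (_, v) = unpair pr b in pr (x, u \<oplus>\<^bsub>V\<^esub> v),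
       \<lambda>x\<in>carrier A. pr (x, \<zero>\<^bsub>V\<^esub>)))"

definition semidirect_func :: "('u \<times> 'u \<Rightarrow> 'u) \<Rightarrow> ('k, 'u) dalg \<Rightarrow>
    (('k, 'u) dbimod, 'u \<Rightarrow> 'u, ('k, 'u) slice_monoid, 'u \<Rightarrow> 'u) func" where
  "semidirect_func pr A = \<lparr>
     FOb = semidirect_monoid pr A,
     FMor = (\<lambda>V W f. \<lambda>z\<in>carrier (semidirect pr A V).
       let (x, u) = unpair pr z in pr (x, f u))\<rparr>"

end

theory Submission
  imports Defs
begin

text \<open>A monoid object \<open>\<phi> : B \<rightarrow> A\<close> with multiplication \<open>M\<close> and unit \<open>i\<close> satisfies \<open>\<phi> \<circ> i = id\<close>. For
  \<open>(b, b')\<close> in the fibre product over \<open>x\<close> one has \<open>(b, b') = (b, i x) + (0, b' - i x)\<close>, so the unit axioms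
  and additivity force \<open>M (b, b') = b + b' - i x\<close>; and for \<open>u, v \<in> ker \<phi>\<close> multiplicativity gives
  \<open>u v = M (u, 0) M (0, v) = M (0, 0) = 0\<close>. Hence monoid objects over \<open>A\<close> are the same as split
  extensions of \<open>A\<close> with square-zero kernel, a morphism of monoid objects being a homomorphism over
  \<open>A\<close> that commutes with the sections. Such an extension is \<open>A \<ltimes> ker \<phi>\<close> by way of
  \<open>b \<mapsto> (\<phi> b, b - i (\<phi> b))\<close>.\<close>

section \<open>Differential algebras and slice categories\<close>

text \<open>Two obstacles shape the argument. The clause \<open>der_unit\<close> does not pass to
  fibre products by itself, since the components of an identity of a fibre product need not be
  identities of the factors. If both structure maps are surjective, every element of a factor occurs
  in some pair, and the components are identities after all. A section makes \<open>\<phi>\<close>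
  surjective, the terminal object is surjective over \<open>A\<close>, and fibre products of
  surjective objects are again surjective; hence every chosen cone in the monoid axioms is a genuine
  product. The same clause has to be verified for the semidirect product, where an identity must
  have zero component in \<open>V\<close>. Moreover, \<open>pairing\<close>, \<open>times\<close>,
  \<open>reassoc\<close> and \<open>to_term\<close> rest on definite descriptions, so the axioms say
  nothing about elements until these maps have been evaluated. After that, all computations take
  place in coordinates \<open>b = i x + u\<close> with \<open>u\<close> in the kernel: the monoid
  laws become laws of addition in the kernel, and the vanishing of \<open>u v\<close> is what makes
  that addition multiplicative.\<close>

lemma linear_onI:
  assumes "\<And>x. x \<in> carrier V \<Longrightarrow> f x \<in> carrier W"
    and "\<And>x y. \<lbrakk>x \<in> carrier V; y \<in> carrier V\<rbrakk> \<Longrightarrow> f (x \<oplus>\<^bsub>V\<^esub> y) = f x \<oplus>\<^bsub>W\<^esub> f y"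
    and "\<And>c x. \<lbrakk>c \<in> carrier K; x \<in> carrier V\<rbrakk> \<Longrightarrow> f (c \<odot>\<^bsub>V\<^esub> x) = c \<odot>\<^bsub>W\<^esub> f x"
  shows "linear_on K V W f"
  using assms by (auto simp: linear_on_def)

lemma linear_on_closed: "\<lbrakk>linear_on K V W f; x \<in> carrier V\<rbrakk> \<Longrightarrow> f x \<in> carrier W"
  and linear_on_add:
    "\<lbrakk>linear_on K V W f; x \<in> carrier V; y \<in> carrier V\<rbrakk> \<Longrightarrow> f (x \<oplus>\<^bsub>V\<^esub> y) = f x \<oplus>\<^bsub>W\<^esub> f y"
  and linear_on_smult:
    "\<lbrakk>linear_on K V W f; c \<in> carrier K; x \<in> carrier V\<rbrakk> \<Longrightarrow> f (c \<odot>\<^bsub>V\<^esub> x) = c \<odot>\<^bsub>W\<^esub> f x"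
  by (auto simp: linear_on_def)

lemma linear_on_zero:
  assumes "abelian_group V" "abelian_group W" "linear_on K V W f"
  shows "f \<zero>\<^bsub>V\<^esub> = \<zero>\<^bsub>W\<^esub>"
proof -
  interpret V: abelian_group V by fact
  interpret W: abelian_group W by fact
  have "f \<zero>\<^bsub>V\<^esub> \<oplus>\<^bsub>W\<^esub> f \<zero>\<^bsub>V\<^esub> = f \<zero>\<^bsub>V\<^esub>"
    using linear_on_add[OF assms(3), of "\<zero>\<^bsub>V\<^esub>" "\<zero>\<^bsub>V\<^esub>"] by simp
  with linear_on_closed[OF assms(3) V.zero_closed] show ?thesis by simp
qed

lemma linear_on_a_inv:
  assumes "abelian_group V" "abelian_group W" "linear_on K V W f" and x: "x \<in> carrier V"
  shows "f (\<ominus>\<^bsub>V\<^esub> x) = \<ominus>\<^bsub>W\<^esub> f x"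
proof -
  interpret V: abelian_group V by fact
  interpret W: abelian_group W by fact
  have "f (\<ominus>\<^bsub>V\<^esub> x) \<oplus>\<^bsub>W\<^esub> f x = \<zero>\<^bsub>W\<^esub>"
    using linear_on_add[OF assms(3), of "\<ominus>\<^bsub>V\<^esub> x" x] linear_on_zero[OF assms(1-3)] x
    by (simp add: V.l_neg)
  then show ?thesis
    using x linear_on_closed[OF assms(3)] by (intro W.minus_equality[symmetric]) simp_all
qed

context diff_algebra
begin

lemmas add_simps [simp] = M.a_closed M.zero_closed M.a_inv_closed M.l_zero M.r_zero

lemma mult_closed [simp]: "\<lbrakk>x \<in> carrier A; y \<in> carrier A\<rbrakk> \<Longrightarrow> x \<otimes>\<^bsub>A\<^esub> y \<in> carrier A"
  by (rule linear_on_closed[OF mult_linear_right])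

lemma der_closed [simp]: "x \<in> carrier A \<Longrightarrow> der A x \<in> carrier A"
  by (rule linear_on_closed[OF der_linear])

lemma mult_add_right:
  "\<lbrakk>x \<in> carrier A; y \<in> carrier A; z \<in> carrier A\<rbrakk>
    \<Longrightarrow> x \<otimes>\<^bsub>A\<^esub> (y \<oplus>\<^bsub>A\<^esub> z) = x \<otimes>\<^bsub>A\<^esub> y \<oplus>\<^bsub>A\<^esub> x \<otimes>\<^bsub>A\<^esub> z"
  by (rule linear_on_add[OF mult_linear_right])

lemma mult_add_left:
  "\<lbrakk>x \<in> carrier A; y \<in> carrier A; z \<in> carrier A\<rbrakk>
    \<Longrightarrow> (y \<oplus>\<^bsub>A\<^esub> z) \<otimes>\<^bsub>A\<^esub> x = y \<otimes>\<^bsub>A\<^esub> x \<oplus>\<^bsub>A\<^esub> z \<otimes>\<^bsub>A\<^esub> x"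
  by (rule linear_on_add[OF mult_linear_left])

lemma mult_smult_right:
  "\<lbrakk>c \<in> carrier K; x \<in> carrier A; y \<in> carrier A\<rbrakk>
    \<Longrightarrow> x \<otimes>\<^bsub>A\<^esub> (c \<odot>\<^bsub>A\<^esub> y) = c \<odot>\<^bsub>A\<^esub> (x \<otimes>\<^bsub>A\<^esub> y)"
  by (rule linear_on_smult[OF mult_linear_right])

lemma mult_smult_left:
  "\<lbrakk>c \<in> carrier K; x \<in> carrier A; y \<in> carrier A\<rbrakk>
    \<Longrightarrow> (c \<odot>\<^bsub>A\<^esub> x) \<otimes>\<^bsub>A\<^esub> y = c \<odot>\<^bsub>A\<^esub> (x \<otimes>\<^bsub>A\<^esub> y)"
  by (rule linear_on_smult[OF mult_linear_left])

lemma mult_zero_right [simp]: "x \<in> carrier A \<Longrightarrow> x \<otimes>\<^bsub>A\<^esub> \<zero>\<^bsub>A\<^esub> = \<zero>\<^bsub>A\<^esub>"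
  by (rule linear_on_zero[OF M.abelian_group_axioms M.abelian_group_axioms mult_linear_right])

lemma mult_zero_left [simp]: "x \<in> carrier A \<Longrightarrow> \<zero>\<^bsub>A\<^esub> \<otimes>\<^bsub>A\<^esub> x = \<zero>\<^bsub>A\<^esub>"
  by (rule linear_on_zero[OF M.abelian_group_axioms M.abelian_group_axioms mult_linear_left])

lemma der_add:
  "\<lbrakk>x \<in> carrier A; y \<in> carrier A\<rbrakk> \<Longrightarrow> der A (x \<oplus>\<^bsub>A\<^esub> y) = der A x \<oplus>\<^bsub>A\<^esub> der A y"
  by (rule linear_on_add[OF der_linear])

lemma der_smult:
  "\<lbrakk>c \<in> carrier K; x \<in> carrier A\<rbrakk> \<Longrightarrow> der A (c \<odot>\<^bsub>A\<^esub> x) = c \<odot>\<^bsub>A\<^esub> der A x"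
  by (rule linear_on_smult[OF der_linear])

lemma der_zero [simp]: "der A \<zero>\<^bsub>A\<^esub> = \<zero>\<^bsub>A\<^esub>"
  by (rule linear_on_zero[OF M.abelian_group_axioms M.abelian_group_axioms der_linear])

lemma id_hom: "diff_algebra_hom K lam A A (\<lambda>x\<in>carrier A. x)"
  by unfold_locales (auto intro!: linear_onI)

end

lemma diff_algebraI:
  assumes "module K A"
    and "\<And>x y. \<lbrakk>x \<in> carrier A; y \<in> carrier A\<rbrakk> \<Longrightarrow> x \<otimes>\<^bsub>A\<^esub> y \<in> carrier A"
    and "\<And>x. x \<in> carrier A \<Longrightarrow> der A x \<in> carrier A"
    and "\<And>x y z. \<lbrakk>x \<in> carrier A; y \<in> carrier A; z \<in> carrier A\<rbrakk>
      \<Longrightarrow> x \<otimes>\<^bsub>A\<^esub> (y \<oplus>\<^bsub>A\<^esub> z) = x \<otimes>\<^bsub>A\<^esub> y \<oplus>\<^bsub>A\<^esub> x \<otimes>\<^bsub>A\<^esub> z"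
    and "\<And>x y z. \<lbrakk>x \<in> carrier A; y \<in> carrier A; z \<in> carrier A\<rbrakk>
      \<Longrightarrow> (y \<oplus>\<^bsub>A\<^esub> z) \<otimes>\<^bsub>A\<^esub> x = y \<otimes>\<^bsub>A\<^esub> x \<oplus>\<^bsub>A\<^esub> z \<otimes>\<^bsub>A\<^esub> x"
    and "\<And>c x y. \<lbrakk>c \<in> carrier K; x \<in> carrier A; y \<in> carrier A\<rbrakk>
      \<Longrightarrow> x \<otimes>\<^bsub>A\<^esub> (c \<odot>\<^bsub>A\<^esub> y) = c \<odot>\<^bsub>A\<^esub> (x \<otimes>\<^bsub>A\<^esub> y)"
    and "\<And>c x y. \<lbrakk>c \<in> carrier K; x \<in> carrier A; y \<in> carrier A\<rbrakk>
      \<Longrightarrow> (c \<odot>\<^bsub>A\<^esub> x) \<otimes>\<^bsub>A\<^esub> y = c \<odot>\<^bsub>A\<^esub> (x \<otimes>\<^bsub>A\<^esub> y)"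
    and "\<And>x y z. \<lbrakk>x \<in> carrier A; y \<in> carrier A; z \<in> carrier A\<rbrakk>
      \<Longrightarrow> (x \<otimes>\<^bsub>A\<^esub> y) \<otimes>\<^bsub>A\<^esub> z = x \<otimes>\<^bsub>A\<^esub> (y \<otimes>\<^bsub>A\<^esub> z)"
    and "\<And>x y. \<lbrakk>x \<in> carrier A; y \<in> carrier A\<rbrakk> \<Longrightarrow> der A (x \<oplus>\<^bsub>A\<^esub> y) = der A x \<oplus>\<^bsub>A\<^esub> der A y"
    and "\<And>c x. \<lbrakk>c \<in> carrier K; x \<in> carrier A\<rbrakk> \<Longrightarrow> der A (c \<odot>\<^bsub>A\<^esub> x) = c \<odot>\<^bsub>A\<^esub> der A x"
    and "\<And>x y. \<lbrakk>x \<in> carrier A; y \<in> carrier A\<rbrakk> \<Longrightarrow>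
      der A (x \<otimes>\<^bsub>A\<^esub> y) =
        der A x \<otimes>\<^bsub>A\<^esub> y \<oplus>\<^bsub>A\<^esub> x \<otimes>\<^bsub>A\<^esub> der A y \<oplus>\<^bsub>A\<^esub> lam \<odot>\<^bsub>A\<^esub> (der A x \<otimes>\<^bsub>A\<^esub> der A y)"
    and "\<And>e. \<lbrakk>e \<in> carrier A; \<And>x. x \<in> carrier A \<Longrightarrow> e \<otimes>\<^bsub>A\<^esub> x = x \<and> x \<otimes>\<^bsub>A\<^esub> e = x\<rbrakk>
      \<Longrightarrow> der A e = \<zero>\<^bsub>A\<^esub>"
  shows "diff_algebra K lam A"
proof -
  interpret module K A by fact
  show ?thesis
    by unfold_locales (blast intro: assms linear_onI)+
qed

lemma diff_algebra_homI:
  assumes "diff_algebra K lam A" "diff_algebra K lam B" "f \<in> extensional (carrier A)"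
    and "\<And>x. x \<in> carrier A \<Longrightarrow> f x \<in> carrier B"
    and "\<And>x y. \<lbrakk>x \<in> carrier A; y \<in> carrier A\<rbrakk> \<Longrightarrow> f (x \<oplus>\<^bsub>A\<^esub> y) = f x \<oplus>\<^bsub>B\<^esub> f y"
    and "\<And>c x. \<lbrakk>c \<in> carrier K; x \<in> carrier A\<rbrakk> \<Longrightarrow> f (c \<odot>\<^bsub>A\<^esub> x) = c \<odot>\<^bsub>B\<^esub> f x"
    and "\<And>x y. \<lbrakk>x \<in> carrier A; y \<in> carrier A\<rbrakk> \<Longrightarrow> f (x \<otimes>\<^bsub>A\<^esub> y) = f x \<otimes>\<^bsub>B\<^esub> f y"
    and "\<And>x. x \<in> carrier A \<Longrightarrow> f (der A x) = der B (f x)"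
  shows "diff_algebra_hom K lam A B f"
  by (intro diff_algebra_hom.intro diff_algebra_hom_axioms.intro linear_onI assms)

context diff_algebra_hom
begin

lemma hom_closed [simp]: "x \<in> carrier A \<Longrightarrow> f x \<in> carrier B"
  by (rule linear_on_closed[OF linear])

lemma hom_add: "\<lbrakk>x \<in> carrier A; y \<in> carrier A\<rbrakk> \<Longrightarrow> f (x \<oplus>\<^bsub>A\<^esub> y) = f x \<oplus>\<^bsub>B\<^esub> f y"
  by (rule linear_on_add[OF linear])

lemma hom_smult: "\<lbrakk>c \<in> carrier K; x \<in> carrier A\<rbrakk> \<Longrightarrow> f (c \<odot>\<^bsub>A\<^esub> x) = c \<odot>\<^bsub>B\<^esub> f x"
  by (rule linear_on_smult[OF linear])

lemma hom_zero: "f \<zero>\<^bsub>A\<^esub> = \<zero>\<^bsub>B\<^esub>"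
  by (rule linear_on_zero[OF dom.M.abelian_group_axioms cod.M.abelian_group_axioms linear])

lemma hom_a_inv: "x \<in> carrier A \<Longrightarrow> f (\<ominus>\<^bsub>A\<^esub> x) = \<ominus>\<^bsub>B\<^esub> f x"
  by (rule linear_on_a_inv[OF dom.M.abelian_group_axioms cod.M.abelian_group_axioms linear])

lemma hom_minus: "\<lbrakk>x \<in> carrier A; y \<in> carrier A\<rbrakk> \<Longrightarrow> f (x \<ominus>\<^bsub>A\<^esub> y) = f x \<ominus>\<^bsub>B\<^esub> f y"
  by (simp add: a_minus_def hom_add hom_a_inv)

lemmas hom_simps = hom_add hom_smult hom_zero hom_a_inv hom_minus mult der

end

lemma diff_algebra_hom_compose:
  assumes "diff_algebra_hom K lam A B f" "diff_algebra_hom K lam B C g"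
  shows "diff_algebra_hom K lam A C (compose (carrier A) g f)"
proof -
  interpret f: diff_algebra_hom K lam A B f by fact
  interpret g: diff_algebra_hom K lam B C g by fact
  show ?thesis
    by (intro diff_algebra_homI f.dom.diff_algebra_axioms g.cod.diff_algebra_axioms)
      (auto simp: compose_def f.hom_simps g.hom_simps)
qed

lemma category_DA: "category (DA K lam)"
proof (unfold_locales, goal_cases)
  \<comment> \<open>The two identity laws rest on extensionality: off the carrier both sides are
    \<open>undefined\<close>.\<close>
  case (3 X Y f)
  then interpret diff_algebra_hom K lam X Y f by (simp add: DA_def)
  show ?case by (auto simp: DA_def compose_def fun_eq_iff intro: extensional_arb[OF ext, symmetric])
next
  case (4 X Y f)
  then interpret diff_algebra_hom K lam X Y f by (simp add: DA_def)
  show ?case by (auto simp: DA_def compose_def fun_eq_iff intro: extensional_arb[OF ext, symmetric])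
next
  case (5 W X Y Z f g h)
  then interpret diff_algebra_hom K lam W X f by (simp add: DA_def)
  show ?case by (auto simp: DA_def compose_def fun_eq_iff)
qed (auto simp: DA_def intro: diff_algebra.id_hom diff_algebra_hom_compose)

lemma category_slice:
  assumes "category C" "A \<in> Ob C"
  shows "category (slice C A)"
proof -
  interpret category C by fact
  show ?thesis
  proof (unfold_locales, goal_cases)
    \<comment> \<open>The triangle of a composite commutes by associativity in \<open>C\<close>,
      applied to a chain that ends in \<open>A\<close>; this is where \<open>A\<close> has to be an
      object.\<close>
    case (2 X Y Z f g)
    then show ?case
      using assms(2) by (auto simp: slice_def intro: Cmp_in) (metis Cmp_assoc)
  next
    case (5 W X Y Z f g h)
    then show ?case by (auto simp: slice_def intro: Cmp_assoc)
  qed (auto simp: slice_def Idm_in Cmp_Idm Idm_Cmp assms(2))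
qed


section \<open>Fibre products over a differential algebra\<close>

lemma carrier_fibre_product:
  "carrier (fibre_product pr X Y) =
    pr ` {(a, b). a \<in> carrier (fst X) \<and> b \<in> carrier (fst Y) \<and> snd X a = snd Y b}"
  by (simp add: fibre_product_def split: prod.split)

lemma fibre_productE:
  assumes "z \<in> carrier (fibre_product pr X Y)"
  obtains a b where "z = pr (a, b)" "a \<in> carrier (fst X)" "b \<in> carrier (fst Y)" "snd X a = snd Y b"
  using assms by (auto simp: carrier_fibre_product)

lemma fibre_product_simps:
  assumes "inj pr"
  shows "pr (a, b) \<in> carrier (fibre_product pr X Y) \<longleftrightarrow>
      a \<in> carrier (fst X) \<and> b \<in> carrier (fst Y) \<and> snd X a = snd Y b"
    and "pr (a, b) \<oplus>\<^bsub>fibre_product pr X Y\<^esub> pr (a', b') = pr (a \<oplus>\<^bsub>fst X\<^esub> a', b \<oplus>\<^bsub>fst Y\<^esub> b')"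
    and "pr (a, b) \<otimes>\<^bsub>fibre_product pr X Y\<^esub> pr (a', b') = pr (a \<otimes>\<^bsub>fst X\<^esub> a', b \<otimes>\<^bsub>fst Y\<^esub> b')"
    and "c \<odot>\<^bsub>fibre_product pr X Y\<^esub> pr (a, b) = pr (c \<odot>\<^bsub>fst X\<^esub> a, c \<odot>\<^bsub>fst Y\<^esub> b)"
    and "\<zero>\<^bsub>fibre_product pr X Y\<^esub> = pr (\<zero>\<^bsub>fst X\<^esub>, \<zero>\<^bsub>fst Y\<^esub>)"
    and "der (fibre_product pr X Y) (pr (a, b)) = pr (der (fst X) a, der (fst Y) b)"
  using assms by (auto simp: fibre_product_def inj_eq split: prod.splits)

text \<open>Surjectivity of both structure maps makes the components of a unit of the fibre product
  units of the factors; this is what the clause \<open>der_unit\<close> needs.\<close>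

lemma fibre_product_diff_algebra:
  assumes pr: "inj pr" and lam: "lam \<in> carrier K"
    and X: "diff_algebra_hom K lam (fst X) A (snd X)" and Y: "diff_algebra_hom K lam (fst Y) A (snd Y)"
    and surjX: "carrier A \<subseteq> snd X ` carrier (fst X)" and surjY: "carrier A \<subseteq> snd Y ` carrier (fst Y)"
  shows "diff_algebra K lam (fibre_product pr X Y)" (is "diff_algebra K lam ?P")
proof -
  interpret X: diff_algebra_hom K lam "fst X" A "snd X" by fact
  interpret Y: diff_algebra_hom K lam "fst Y" A "snd Y" by fact
  note [simp] = fibre_product_simps[OF pr] X.hom_simps Y.hom_simps inj_eq[OF pr] lam
  have module: "module K ?P"
  proof (intro moduleI abelian_groupI X.dom.R.cring_axioms, goal_cases)
    case (6 x)
    then obtain a b where ab: "x = pr (a, b)" "pr (a, b) \<in> carrier ?P"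
      by (auto elim!: fibre_productE)
    then show ?case
      by (intro bexI[of _ "pr (\<ominus>\<^bsub>fst X\<^esub> a, \<ominus>\<^bsub>fst Y\<^esub> b)"]) (auto simp: X.dom.M.l_neg Y.dom.M.l_neg)
  qed (auto elim!: fibre_productE simp: X.dom.M.a_ac Y.dom.M.a_ac X.dom.smult_l_distr
      Y.dom.smult_l_distr X.dom.smult_r_distr Y.dom.smult_r_distr X.dom.smult_assoc1 Y.dom.smult_assoc1)
  show ?thesis
  proof (intro diff_algebraI module, goal_cases)
    case (11 e)
    then obtain a b where e: "e = pr (a, b)" "pr (a, b) \<in> carrier ?P"
      by (auto elim!: fibre_productE)
    have unit: "a \<otimes>\<^bsub>fst X\<^esub> a' = a' \<and> a' \<otimes>\<^bsub>fst X\<^esub> a = a' \<and>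
        b \<otimes>\<^bsub>fst Y\<^esub> b' = b' \<and> b' \<otimes>\<^bsub>fst Y\<^esub> b = b'"
      if "a' \<in> carrier (fst X)" "b' \<in> carrier (fst Y)" "snd X a' = snd Y b'" for a' b'
      using 11(2)[of "pr (a', b')"] that e by simp
    have "a \<otimes>\<^bsub>fst X\<^esub> a' = a' \<and> a' \<otimes>\<^bsub>fst X\<^esub> a = a'" if "a' \<in> carrier (fst X)" for a'
    proof -
      have "snd X a' \<in> snd Y ` carrier (fst Y)" using surjY that by auto
      then show ?thesis using unit[of a'] that by auto
    qed
    then have "der (fst X) a = \<zero>\<^bsub>fst X\<^esub>"
      using e by (intro X.dom.der_unit) auto
    moreover have "b \<otimes>\<^bsub>fst Y\<^esub> b' = b' \<and> b' \<otimes>\<^bsub>fst Y\<^esub> b = b'" if "b' \<in> carrier (fst Y)" for b'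
    proof -
      have "snd Y b' \<in> snd X ` carrier (fst X)" using surjX that by auto
      then show ?thesis using unit[of _ b'] that by auto
    qed
    then have "der (fst Y) b = \<zero>\<^bsub>fst Y\<^esub>"
      using e by (intro Y.dom.der_unit) auto
    ultimately show ?case by (simp add: e)
  qed (auto elim!: fibre_productE simp: X.dom.mult_add_right Y.dom.mult_add_right
      X.dom.mult_add_left Y.dom.mult_add_left X.dom.mult_smult_right Y.dom.mult_smult_right
      X.dom.mult_smult_left Y.dom.mult_smult_left X.dom.mult_assoc Y.dom.mult_assoc
      X.dom.der_add Y.dom.der_add X.dom.der_smult Y.dom.der_smult X.dom.der_mult Y.dom.der_mult)
qed

section \<open>Elementwise description of the slice category and of its chosen products\<close>

locale diff_slice = diff_algebra K lam A
  for K :: "('k, 'r) ring_scheme" and lam :: 'k and A :: "('k, 'u) dalg" +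
  fixes pr :: "'u \<times> 'u \<Rightarrow> 'u"
  assumes lam_closed [simp]: "lam \<in> carrier K"
    and inj_pr: "inj pr"
begin

abbreviation "DA_over \<equiv> slice (DA K lam) A"
abbreviation "prods \<equiv> slice_products pr A"

lemmas unpair_simp [simp] = unpair_pr[OF inj_pr]
lemmas pr_eq_iff [simp] = inj_eq[OF inj_pr]
lemmas fibre_simps [simp] = fibre_product_simps[OF inj_pr]

lemma category_DA_over: "category DA_over"
  by (intro category_slice category_DA) (simp add: DA_def diff_algebra_axioms)

sublocale slice: category DA_over
  by (rule category_DA_over)

lemma Ob_DA_over: "X \<in> Ob DA_over \<longleftrightarrow> diff_algebra_hom K lam (fst X) A (snd X)"
  by (cases X) (auto simp: slice_def DA_def diff_algebra_hom.axioms)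

lemma Mor_DA_over:
  "f \<in> Mor DA_over X Y \<longleftrightarrow>
    diff_algebra_hom K lam (fst X) (fst Y) f \<and> compose (carrier (fst X)) (snd Y) f = snd X"
  by (cases X; cases Y) (auto simp: slice_def DA_def)

lemma Cmp_DA_over [simp]: "Cmp DA_over X Y Z g f = compose (carrier (fst X)) g f"
  by (cases X; cases Y; cases Z) (auto simp: slice_def DA_def)

lemma Idm_DA_over [simp]: "Idm DA_over X = (\<lambda>x\<in>carrier (fst X). x)"
  by (cases X) (auto simp: slice_def DA_def)

text \<open>The triangle is an equation between extensional functions. It suffices to check it on
  the carrier, because off the carrier \<open>snd X\<close> is \<open>undefined\<close>, as is the
  composite.\<close>

lemma Mor_DA_overI:
  assumes "X \<in> Ob DA_over" "diff_algebra_hom K lam (fst X) (fst Y) f"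
    and "\<And>x. x \<in> carrier (fst X) \<Longrightarrow> snd Y (f x) = snd X x"
  shows "f \<in> Mor DA_over X Y"
proof -
  interpret X: diff_algebra_hom K lam "fst X" A "snd X" using assms(1) by (simp add: Ob_DA_over)
  show ?thesis
    using assms(2,3) by (auto simp: Mor_DA_over compose_def fun_eq_iff intro: extensional_arb[OF X.ext, symmetric])
qed

lemma Mor_DA_over_apply:
  assumes "f \<in> Mor DA_over X Y" "x \<in> carrier (fst X)"
  shows "f x \<in> carrier (fst Y)" "snd Y (f x) = snd X x"
proof -
  interpret f: diff_algebra_hom K lam "fst X" "fst Y" f using assms(1) by (simp add: Mor_DA_over)
  show "f x \<in> carrier (fst Y)" using assms(2) by simp
  have "compose (carrier (fst X)) (snd Y) f x = snd X x"
    using assms(1) by (simp add: Mor_DA_over)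
  then show "snd Y (f x) = snd X x" using assms(2) by (simp add: compose_def)
qed

lemma Term_prods: "Term prods = (A, \<lambda>x\<in>carrier A. x)"
  by (simp add: slice_products_def)

lemma fst_Prod [simp]: "fst (Prod prods X Y) = fibre_product pr X Y"
  and snd_Prod: "snd (Prod prods X Y) =
    (\<lambda>z\<in>carrier (fibre_product pr X Y). snd X (fst (unpair pr z)))"
  by (simp_all add: slice_products_def)

text \<open>Surjectivity of the structure map singles out a class of objects on which fibre products
  are again differential algebras. It contains the terminal object and is closed under
  \<open>Prod\<close>, so it contains every object built from a split extension in the monoid
  axioms.\<close>

definition surjective_over :: "('k, 'u) dalg \<times> ('u \<Rightarrow> 'u) \<Rightarrow> bool" where
  "surjective_over X \<longleftrightarrow> X \<in> Ob DA_over \<and> carrier A \<subseteq> snd X ` carrier (fst X)"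

lemma surjective_over_Ob: "surjective_over X \<Longrightarrow> X \<in> Ob DA_over"
  by (simp add: surjective_over_def)

lemma surjective_over_Term: "surjective_over (Term prods)"
  by (auto simp: surjective_over_def Ob_DA_over Term_prods id_hom)

lemma Prod_is_product:
  assumes "surjective_over X" "surjective_over Y"
  shows "is_product DA_over X Y (Prod prods X Y) (Prj1 prods X Y) (Prj2 prods X Y)"
  using assms unfolding surjective_over_def
  by (intro slice_product inj_pr fibre_product_diff_algebra[where A = A]) (auto simp: Ob_DA_over inj_pr)

lemma surjective_over_Prod:
  assumes "surjective_over X" "surjective_over Y"
  shows "surjective_over (Prod prods X Y)"
proof -
  have "carrier A \<subseteq> snd (Prod prods X Y) ` carrier (fibre_product pr X Y)"
  proof
    fix x assume "x \<in> carrier A"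
    then have "x \<in> snd X ` carrier (fst X)" "x \<in> snd Y ` carrier (fst Y)"
      using assms unfolding surjective_over_def by blast+
    then obtain a b where "a \<in> carrier (fst X)" "b \<in> carrier (fst Y)" "x = snd X a" "x = snd Y b"
      by blast
    then show "x \<in> snd (Prod prods X Y) ` carrier (fibre_product pr X Y)"
      by (intro image_eqI[of _ _ "pr (a, b)"]) (simp_all add: snd_Prod)
  qed
  then show ?thesis
    using Prod_is_product[OF assms] by (simp add: surjective_over_def is_product_def)
qed

lemma Prj_apply:
  assumes "pr (a, b) \<in> carrier (fibre_product pr X Y)"
  shows "Prj1 prods X Y (pr (a, b)) = a" "Prj2 prods X Y (pr (a, b)) = b"
  using assms by (simp_all add: slice_products_def)

text \<open>\<open>pairing\<close> is a definite description. The universal property shows that it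
  denotes a morphism, and the two projection equations then determine its value at each
  element.\<close>

lemma pairing_DA_over:
  assumes X: "surjective_over X" and Y: "surjective_over Y" and Z: "Z \<in> Ob DA_over"
    and f: "f \<in> Mor DA_over Z X" and g: "g \<in> Mor DA_over Z Y"
  shows "pairing DA_over prods Z X Y f g \<in> Mor DA_over Z (Prod prods X Y)"
    and "z \<in> carrier (fst Z) \<Longrightarrow> pairing DA_over prods Z X Y f g z = pr (f z, g z)"
proof -
  define h where "h = pairing DA_over prods Z X Y f g"
  have "\<exists>!h. h \<in> Mor DA_over Z (Prod prods X Y) \<and>
      Cmp DA_over Z (Prod prods X Y) X (Prj1 prods X Y) h = f \<and>
      Cmp DA_over Z (Prod prods X Y) Y (Prj2 prods X Y) h = g"
    using Prod_is_product[OF X Y] Z f g by (simp add: is_product_def)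
  from theI'[OF this] have h: "h \<in> Mor DA_over Z (Prod prods X Y)"
    and hf: "compose (carrier (fst Z)) (Prj1 prods X Y) h = f"
    and hg: "compose (carrier (fst Z)) (Prj2 prods X Y) h = g"
    by (simp_all add: h_def pairing_def)
  from h show "pairing DA_over prods Z X Y f g \<in> Mor DA_over Z (Prod prods X Y)"
    by (simp add: h_def)
  assume z: "z \<in> carrier (fst Z)"
  with h have "h z \<in> carrier (fibre_product pr X Y)"
    using Mor_DA_over_apply by fastforce
  then obtain a b where ab: "h z = pr (a, b)" "pr (a, b) \<in> carrier (fibre_product pr X Y)"
    by (auto elim!: fibre_productE)
  have "f z = a" "g z = b"
    using z ab by (simp_all add: hf[symmetric] hg[symmetric] compose_def Prj_apply)
  then show "pairing DA_over prods Z X Y f g z = pr (f z, g z)"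
    using ab by (simp add: h_def)
qed

lemma times_DA_over:
  assumes X: "surjective_over X" "surjective_over Y" and X': "surjective_over X'" "surjective_over Y'"
    and f: "f \<in> Mor DA_over X X'" and g: "g \<in> Mor DA_over Y Y'"
  shows "times DA_over prods X Y X' Y' f g \<in> Mor DA_over (Prod prods X Y) (Prod prods X' Y')"
    and "pr (a, b) \<in> carrier (fibre_product pr X Y) \<Longrightarrow>
      times DA_over prods X Y X' Y' f g (pr (a, b)) = pr (f a, g b)"
proof -
  note P = Prod_is_product[OF X, unfolded is_product_def]
  \<comment> \<open>The composites stay in the form \<open>Cmp\<close> so that closure under
    composition in the slice category applies; \<open>Cmp_DA_over\<close> would turn them into
    \<open>compose\<close>.\<close>
  have f': "Cmp DA_over (Prod prods X Y) X X' f (Prj1 prods X Y) \<in> Mor DA_over (Prod prods X Y) X'"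
    and g': "Cmp DA_over (Prod prods X Y) Y Y' g (Prj2 prods X Y) \<in> Mor DA_over (Prod prods X Y) Y'"
    using P f g X' by (auto intro!: slice.Cmp_in simp del: Cmp_DA_over simp: surjective_over_Ob)
  have PO: "Prod prods X Y \<in> Ob DA_over" using P by simp
  note pair = pairing_DA_over[OF X' PO f' g']
  show "times DA_over prods X Y X' Y' f g \<in> Mor DA_over (Prod prods X Y) (Prod prods X' Y')"
    using pair(1) by (simp add: times_def)
  show "times DA_over prods X Y X' Y' f g (pr (a, b)) = pr (f a, g b)"
    if "pr (a, b) \<in> carrier (fibre_product pr X Y)"
    using pair(2)[of "pr (a, b)"] that
    by (simp add: times_def compose_def Prj_apply del: fibre_simps(1))
qed

text \<open>Two nested pairings are evaluated, the inner one with target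
  \<open>Prod prods Y Z\<close>. The outer one needs that target to be surjective over
  \<open>A\<close>, which \<open>surjective_over_Prod\<close> supplies.\<close>

lemma reassoc_DA_over:
  assumes X: "surjective_over X" and Y: "surjective_over Y" and Z: "surjective_over Z"
  shows "reassoc DA_over prods X Y Z \<in>
      Mor DA_over (Prod prods (Prod prods X Y) Z) (Prod prods X (Prod prods Y Z))"
    and "pr (pr (a, b), c) \<in> carrier (fibre_product pr (Prod prods X Y) Z) \<Longrightarrow>
      reassoc DA_over prods X Y Z (pr (pr (a, b), c)) = pr (a, pr (b, c))"
proof -
  let ?XY = "Prod prods X Y" and ?YZ = "Prod prods Y Z"
  let ?P = "Prod prods ?XY Z"
  note XY = surjective_over_Prod[OF X Y] and YZ = surjective_over_Prod[OF Y Z]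
  note P = surjective_over_Prod[OF XY Z]
  note p1 = Prod_is_product[OF X Y, unfolded is_product_def]
    and p2 = Prod_is_product[OF XY Z, unfolded is_product_def]
  have f: "Cmp DA_over ?P ?XY X (Prj1 prods X Y) (Prj1 prods ?XY Z) \<in> Mor DA_over ?P X"
    and g: "Cmp DA_over ?P ?XY Y (Prj2 prods X Y) (Prj1 prods ?XY Z) \<in> Mor DA_over ?P Y"
    and h: "Prj2 prods ?XY Z \<in> Mor DA_over ?P Z"
    using p1 p2 by (auto intro!: slice.Cmp_in simp del: Cmp_DA_over)
  note gh = pairing_DA_over[OF Y Z surjective_over_Ob[OF P] g h]
  note fgh = pairing_DA_over[OF X YZ surjective_over_Ob[OF P] f gh(1)]
  show "reassoc DA_over prods X Y Z \<in> Mor DA_over ?P (Prod prods X ?YZ)"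
    using fgh(1) by (simp add: reassoc_def Let_def)
  assume abc: "pr (pr (a, b), c) \<in> carrier (fibre_product pr ?XY Z)"
  then have "pr (a, b) \<in> carrier (fibre_product pr X Y)" by simp
  with abc show "reassoc DA_over prods X Y Z (pr (pr (a, b), c)) = pr (a, pr (b, c))"
    using fgh(2)[of "pr (pr (a, b), c)"] gh(2)[of "pr (pr (a, b), c)"]
    by (simp add: reassoc_def Let_def compose_def Prj_apply del: fibre_simps(1))
qed

text \<open>A structure map is itself a morphism to the identity of \<open>A\<close>, so uniqueness
  identifies it with the described one.\<close>

lemma to_term_DA_over:
  assumes "X \<in> Ob DA_over"
  shows "to_term DA_over prods X = snd X" "snd X \<in> Mor DA_over X (Term prods)"
proof -
  interpret X: diff_algebra_hom K lam "fst X" A "snd X" using assms by (simp add: Ob_DA_over)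
  show *: "snd X \<in> Mor DA_over X (Term prods)"
    using assms by (intro Mor_DA_overI) (simp_all add: Term_prods X.diff_algebra_hom_axioms)
  have "\<exists>!t. t \<in> Mor DA_over X (Term prods)"
    using slice_terminal[OF diff_algebra_axioms] assms by (auto simp: is_terminal_def)
  then show "to_term DA_over prods X = snd X"
    using * by (auto simp: to_term_def intro: the1_equality)
qed

end


section \<open>Monoid objects are split square-zero extensions\<close>

text \<open>The multiplication \<open>M\<close> is left out of the data on purpose:
  \<open>fibre_sum\<close> recovers it from \<open>\<phi>\<close> and \<open>i\<close>.\<close>

locale split_extension = proj: diff_algebra_hom K lam B A \<phi> + sec: diff_algebra_hom K lam A B i
  for K :: "('k, 'r) ring_scheme" and lam :: 'k and A B :: "('k, 'u) dalg"
    and \<phi> i :: "'u \<Rightarrow> 'u" +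
  assumes proj_sec [simp]: "x \<in> carrier A \<Longrightarrow> \<phi> (i x) = x"
    and square_zero:
      "\<lbrakk>u \<in> carrier B; v \<in> carrier B; \<phi> u = \<zero>\<^bsub>A\<^esub>; \<phi> v = \<zero>\<^bsub>A\<^esub>\<rbrakk> \<Longrightarrow> u \<otimes>\<^bsub>B\<^esub> v = \<zero>\<^bsub>B\<^esub>"
begin

definition kernel :: "'u set" where
  "kernel = {v \<in> carrier B. \<phi> v = \<zero>\<^bsub>A\<^esub>}"

lemma kernelD [simp]: "v \<in> kernel \<Longrightarrow> v \<in> carrier B" "v \<in> kernel \<Longrightarrow> \<phi> v = \<zero>\<^bsub>A\<^esub>"
  by (simp_all add: kernel_def)

lemma kernel_closed [simp]:
  "\<zero>\<^bsub>B\<^esub> \<in> kernel"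
  "\<lbrakk>u \<in> kernel; v \<in> kernel\<rbrakk> \<Longrightarrow> u \<oplus>\<^bsub>B\<^esub> v \<in> kernel"
  "u \<in> kernel \<Longrightarrow> \<ominus>\<^bsub>B\<^esub> u \<in> kernel"
  "\<lbrakk>c \<in> carrier K; u \<in> kernel\<rbrakk> \<Longrightarrow> c \<odot>\<^bsub>B\<^esub> u \<in> kernel"
  "\<lbrakk>b \<in> carrier B; u \<in> kernel\<rbrakk> \<Longrightarrow> b \<otimes>\<^bsub>B\<^esub> u \<in> kernel"
  "\<lbrakk>b \<in> carrier B; u \<in> kernel\<rbrakk> \<Longrightarrow> u \<otimes>\<^bsub>B\<^esub> b \<in> kernel"
  "u \<in> kernel \<Longrightarrow> der B u \<in> kernel"
  "b \<in> carrier B \<Longrightarrow> b \<ominus>\<^bsub>B\<^esub> i (\<phi> b) \<in> kernel"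
  by (auto simp: kernel_def proj.hom_simps proj.cod.M.r_neg a_minus_def simp del: kernelD)

lemma kernel_mult: "\<lbrakk>u \<in> kernel; v \<in> kernel\<rbrakk> \<Longrightarrow> u \<otimes>\<^bsub>B\<^esub> v = \<zero>\<^bsub>B\<^esub>"
  by (simp add: square_zero)

lemma decompose: "b \<in> carrier B \<Longrightarrow> b = i (\<phi> b) \<oplus>\<^bsub>B\<^esub> (b \<ominus>\<^bsub>B\<^esub> i (\<phi> b))"
  by (simp add: a_minus_def proj.dom.M.a_comm[of b] proj.dom.M.r_neg2)

lemma decomposeE:
  assumes "b \<in> carrier B"
  obtains u where "u \<in> kernel" "b = i (\<phi> b) \<oplus>\<^bsub>B\<^esub> u"
  using decompose assms kernel_closed(8) by blast

lemma proj_decomposed [simp]: "\<lbrakk>x \<in> carrier A; u \<in> kernel\<rbrakk> \<Longrightarrow> \<phi> (i x \<oplus>\<^bsub>B\<^esub> u) = x"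
  by (simp add: proj.hom_simps)

text \<open>Together with \<open>proj_decomposed\<close> this gives uniqueness of the coordinates
  \<open>x\<close> and \<open>u\<close>, and hence one half of the bijection with the semidirect
  product.\<close>

lemma minus_decomposed [simp]: "\<lbrakk>x \<in> carrier A; u \<in> kernel\<rbrakk> \<Longrightarrow> (i x \<oplus>\<^bsub>B\<^esub> u) \<ominus>\<^bsub>B\<^esub> i x = u"
  by (simp add: a_minus_def proj.dom.M.a_ac proj.dom.M.r_neg1 proj.dom.M.r_neg2 proj.dom.M.r_neg)

lemma decomposed_add:
  "\<lbrakk>x \<in> carrier A; y \<in> carrier A; u \<in> kernel; v \<in> kernel\<rbrakk> \<Longrightarrow>
    (i x \<oplus>\<^bsub>B\<^esub> u) \<oplus>\<^bsub>B\<^esub> (i y \<oplus>\<^bsub>B\<^esub> v) = i (x \<oplus>\<^bsub>A\<^esub> y) \<oplus>\<^bsub>B\<^esub> (u \<oplus>\<^bsub>B\<^esub> v)"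
  by (simp add: sec.hom_simps proj.dom.M.a_ac)

lemma decomposed_smult:
  "\<lbrakk>c \<in> carrier K; x \<in> carrier A; u \<in> kernel\<rbrakk> \<Longrightarrow>
    c \<odot>\<^bsub>B\<^esub> (i x \<oplus>\<^bsub>B\<^esub> u) = i (c \<odot>\<^bsub>A\<^esub> x) \<oplus>\<^bsub>B\<^esub> c \<odot>\<^bsub>B\<^esub> u"
  by (simp add: sec.hom_simps proj.dom.smult_r_distr)

text \<open>Of the four products only \<open>u v\<close> is missing on the right; it vanishes by
  \<open>square_zero\<close>. What remains is the product rule of the semidirect product, with
  \<open>A\<close> acting through \<open>i\<close>.\<close>

lemma decomposed_mult:
  "\<lbrakk>x \<in> carrier A; y \<in> carrier A; u \<in> kernel; v \<in> kernel\<rbrakk> \<Longrightarrow>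
    (i x \<oplus>\<^bsub>B\<^esub> u) \<otimes>\<^bsub>B\<^esub> (i y \<oplus>\<^bsub>B\<^esub> v) = i (x \<otimes>\<^bsub>A\<^esub> y) \<oplus>\<^bsub>B\<^esub> (i x \<otimes>\<^bsub>B\<^esub> v \<oplus>\<^bsub>B\<^esub> u \<otimes>\<^bsub>B\<^esub> i y)"
  by (simp add: sec.hom_simps proj.dom.mult_add_left proj.dom.mult_add_right kernel_mult
      proj.dom.M.a_ac)

lemma decomposed_der:
  "\<lbrakk>x \<in> carrier A; u \<in> kernel\<rbrakk> \<Longrightarrow> der B (i x \<oplus>\<^bsub>B\<^esub> u) = i (der A x) \<oplus>\<^bsub>B\<^esub> der B u"
  by (simp add: sec.hom_simps proj.dom.der_add)

lemmas decomposed_simps = decomposed_add decomposed_smult decomposed_mult decomposed_der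

end

text \<open>The bracketing keeps \<open>b' - i (\<phi> b')\<close>, an element of the kernel, as one
  term. On the fibre product \<open>\<phi> b = \<phi> b'\<close>, so the formula does not favour one
  entry. The restriction makes it extensional, so that it can equal a morphism.\<close>

definition fibre_sum ::
    "('u \<times> 'u \<Rightarrow> 'u) \<Rightarrow> ('k, 'u) dalg \<Rightarrow> ('u \<Rightarrow> 'u) \<Rightarrow> ('u \<Rightarrow> 'u) \<Rightarrow> 'u \<Rightarrow> 'u" where
  "fibre_sum pr B \<phi> i = (\<lambda>z\<in>carrier (fibre_product pr (B, \<phi>) (B, \<phi>)).
     let (b, b') = unpair pr z in b \<oplus>\<^bsub>B\<^esub> (b' \<ominus>\<^bsub>B\<^esub> i (\<phi> b')))"

text \<open>In coordinates the map adds the kernel components over a fixed base point; the monoid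
  axioms are checked in this form.\<close>

lemma (in split_extension) fibre_sum_decomposed:
  assumes "inj pr" "x \<in> carrier A" "u \<in> kernel" "v \<in> kernel"
  shows "fibre_sum pr B \<phi> i (pr (i x \<oplus>\<^bsub>B\<^esub> u, i x \<oplus>\<^bsub>B\<^esub> v)) = i x \<oplus>\<^bsub>B\<^esub> (u \<oplus>\<^bsub>B\<^esub> v)"
  using assms
  by (simp add: fibre_sum_def fibre_product_simps unpair_pr proj.dom.M.a_assoc)

lemma (in split_extension) fibre_productE_decomposed:
  assumes "z \<in> carrier (fibre_product pr (B, \<phi>) (B, \<phi>))"
  obtains x u v where "x \<in> carrier A" "u \<in> kernel" "v \<in> kernel"
    "z = pr (i x \<oplus>\<^bsub>B\<^esub> u, i x \<oplus>\<^bsub>B\<^esub> v)"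
proof -
  from assms obtain a b where ab: "z = pr (a, b)" "a \<in> carrier B" "b \<in> carrier B" "\<phi> a = \<phi> b"
    by (auto elim: fibre_productE)
  from ab(2,3) obtain u v where "u \<in> kernel" "a = i (\<phi> a) \<oplus>\<^bsub>B\<^esub> u" "v \<in> kernel" "b = i (\<phi> b) \<oplus>\<^bsub>B\<^esub> v"
    by (metis decomposeE)
  with ab that[of "\<phi> a" u v] show thesis by simp
qed

context diff_slice
begin

lemma split_extension_surjective:
  assumes "split_extension K lam A B \<phi> i"
  shows "surjective_over (B, \<phi>)"
proof -
  interpret split_extension K lam A B \<phi> i by fact
  have "x \<in> \<phi> ` carrier B" if "x \<in> carrier A" for x
    using that by (intro image_eqI[of _ _ "i x"]) simp_all
  then show ?thesis
    by (auto simp: surjective_over_def Ob_DA_over proj.diff_algebra_hom_axioms)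
qed

text \<open>Multiplicativity is the only delicate point. For \<open>(x, u, v)\<close> and
  \<open>(y, u', v')\<close>, the product of the images would contain the cross terms
  \<open>u v'\<close> and \<open>v u'\<close>, whereas the image of the product would contain
  \<open>u u'\<close> and \<open>v v'\<close>. All four vanish because the kernel has square zero,
  and the rest is bilinearity.\<close>

lemma fibre_sum_hom:
  assumes "split_extension K lam A B \<phi> i"
  shows "fibre_sum pr B \<phi> i \<in> Mor DA_over (Prod prods (B, \<phi>) (B, \<phi>)) (B, \<phi>)"
proof -
  interpret split_extension K lam A B \<phi> i by fact
  note surj = split_extension_surjective[OF assms]
  note P = surjective_over_Ob[OF surjective_over_Prod[OF surj surj]]
  have DA: "diff_algebra K lam (fibre_product pr (B, \<phi>) (B, \<phi>))"
    using P by (simp add: Ob_DA_over diff_algebra_hom_def)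
  note [simp] = decomposed_simps fibre_sum_decomposed[OF inj_pr]
  show ?thesis
  proof (intro Mor_DA_overI P diff_algebra_homI, goal_cases)
    case 3 show ?case by (simp add: fibre_sum_def)
  next
    case (7 z w)
    then obtain x u v y u' v' where "x \<in> carrier A" "u \<in> kernel" "v \<in> kernel"
      "z = pr (i x \<oplus>\<^bsub>B\<^esub> u, i x \<oplus>\<^bsub>B\<^esub> v)" "y \<in> carrier A" "u' \<in> kernel" "v' \<in> kernel"
      "w = pr (i y \<oplus>\<^bsub>B\<^esub> u', i y \<oplus>\<^bsub>B\<^esub> v')"
      unfolding fst_Prod by (elim fibre_productE_decomposed)
    \<comment> \<open>The decomposed form is kept until \<open>fibre_sum\<close> has been evaluated
      on both sides; only then are the remaining products distributed over the sums.\<close>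
    then show ?case
      by simp (simp add: proj.dom.mult_add_left proj.dom.mult_add_right proj.dom.M.a_ac)
  next
    case (5 z w)
    then obtain x u v y u' v' where "x \<in> carrier A" "u \<in> kernel" "v \<in> kernel"
      "z = pr (i x \<oplus>\<^bsub>B\<^esub> u, i x \<oplus>\<^bsub>B\<^esub> v)" "y \<in> carrier A" "u' \<in> kernel" "v' \<in> kernel"
      "w = pr (i y \<oplus>\<^bsub>B\<^esub> u', i y \<oplus>\<^bsub>B\<^esub> v')"
      unfolding fst_Prod by (elim fibre_productE_decomposed)
    then show ?case
      by simp (simp add: proj.dom.M.a_ac)
  qed (use DA in \<open>auto elim!: fibre_productE_decomposed simp: snd_Prod proj.dom.diff_algebra_axioms\<close>,
      simp_all add: proj.dom.smult_r_distr proj.dom.der_add)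
qed

text \<open>Once all canonical maps are evaluated at elements, associativity of \<open>M\<close> is
  associativity of addition in the kernel, and the unit axioms are \<open>u + 0 = u\<close> and
  \<open>0 + u = u\<close>.\<close>

lemma monoid_object_split_extension:
  assumes "split_extension K lam A B \<phi> i"
  shows "monoid_object DA_over prods (B, \<phi>) (fibre_sum pr B \<phi> i) i"
proof -
  interpret split_extension K lam A B \<phi> i by fact
  let ?X = "(B, \<phi>)" and ?M = "fibre_sum pr B \<phi> i" and ?T = "Term prods"
  let ?XX = "Prod prods ?X ?X"
  note X = split_extension_surjective[OF assms]
  note XX = surjective_over_Prod[OF X X] and T = surjective_over_Term
  note XO = surjective_over_Ob[OF X]
  note M = fibre_sum_hom[OF assms] and Mv = fibre_sum_decomposed[OF inj_pr]
  have id: "(\<lambda>x\<in>carrier B. x) \<in> Mor DA_over ?X ?X"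
    using slice.Idm_in[OF XO] by simp
  have i: "i \<in> Mor DA_over ?T ?X"
    using surjective_over_Ob[OF T]
    by (intro Mor_DA_overI) (simp_all add: Term_prods sec.diff_algebra_hom_axioms)
  note tX = to_term_DA_over[OF XO]
  note tM1 = times_DA_over[OF XX X X X M id] and tM2 = times_DA_over[OF X XX X X id M]
    and r = reassoc_DA_over[OF X X X]
    and pT = pairing_DA_over[OF X T XO id tX(2)] and Tp = pairing_DA_over[OF T X XO tX(2) id]
    and ti = times_DA_over[OF X T X X id i] and it = times_DA_over[OF T X X X i id]
  show ?thesis
  proof
    show "is_terminal DA_over ?T"
      by (rule slice_terminal[OF diff_algebra_axioms])
    show "is_product DA_over Y Z (Prod prods Y Z) (Prj1 prods Y Z) (Prj2 prods Y Z)"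
      if "(Y, Z) \<in> {(?X, ?X), (?XX, ?X), (?X, ?XX), (?X, ?T), (?T, ?X)}" for Y Z
      using that X XX T by (intro Prod_is_product) auto
    show "?X \<in> Ob DA_over" by fact
    show "?M \<in> Mor DA_over ?XX ?X" by fact
    show "i \<in> Mor DA_over ?T ?X" by fact
  next
    have "?M (times DA_over prods ?XX ?X ?X ?X ?M (\<lambda>x\<in>carrier B. x) z) =
        ?M (times DA_over prods ?X ?XX ?X ?X (\<lambda>x\<in>carrier B. x) ?M (reassoc DA_over prods ?X ?X ?X z))"
      if z: "z \<in> carrier (fibre_product pr ?XX ?X)" for z
    proof -
      from z obtain w b where w: "z = pr (w, b)" "w \<in> carrier (fibre_product pr ?X ?X)"
        "b \<in> carrier B" "snd ?XX w = \<phi> b"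
        by (auto elim: fibre_productE)
      obtain x u v where xuv: "x \<in> carrier A" "u \<in> kernel" "v \<in> kernel"
        "w = pr (i x \<oplus>\<^bsub>B\<^esub> u, i x \<oplus>\<^bsub>B\<^esub> v)"
        using fibre_productE_decomposed[OF w(2)] by blast
      \<comment> \<open>The structure map of the inner product is \<open>\<phi>\<close> of the first
        entry, so the third entry lies over the same \<open>x\<close> and has coordinates
        \<open>x\<close>, \<open>t\<close>.\<close>
      then have "\<phi> b = x" using w by (simp add: snd_Prod)
      then obtain t where "t \<in> kernel" "b = i x \<oplus>\<^bsub>B\<^esub> t"
        using decomposeE[OF w(3)] by blast
      with xuv w(1) show ?thesis
        by (simp add: tM1(2) r(2) tM2(2) snd_Prod Mv proj.dom.M.a_assoc)
    qed
    then show "Cmp DA_over (Prod prods ?XX ?X) ?XX ?X ?M (times DA_over prods ?XX ?X ?X ?X ?M (Idm DA_over ?X)) =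
      Cmp DA_over (Prod prods ?XX ?X) ?XX ?X ?M
       (Cmp DA_over (Prod prods ?XX ?X) (Prod prods ?X ?XX) ?XX
         (times DA_over prods ?X ?XX ?X ?X (Idm DA_over ?X) ?M)
         (reassoc DA_over prods ?X ?X ?X))"
      by (auto simp: compose_def fun_eq_iff)
  next
    have "?M (times DA_over prods ?X ?T ?X ?X (\<lambda>x\<in>carrier B. x) i
       (pairing DA_over prods ?X ?X ?T (\<lambda>x\<in>carrier B. x) (to_term DA_over prods ?X) b)) = b"
      if b: "b \<in> carrier B" for b
    proof -
      obtain u where "u \<in> kernel" "b = i (\<phi> b) \<oplus>\<^bsub>B\<^esub> u" using b decomposeE by blast
      \<comment> \<open>The map reached here sends \<open>b\<close> to the pair
        \<open>(b, i (\<phi> b))\<close>, whose second entry has kernel component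
        \<open>0\<close>.\<close>
      then show ?thesis
        using b Mv[of "\<phi> b" u "\<zero>\<^bsub>B\<^esub>"]
          by (simp add: tX(1) pT(2)[simplified Term_prods, simplified]
            ti(2)[simplified Term_prods, simplified] Term_prods)
    qed
    then show "Cmp DA_over ?X ?XX ?X ?M
       (Cmp DA_over ?X (Prod prods ?X ?T) ?XX (times DA_over prods ?X ?T ?X ?X (Idm DA_over ?X) i)
         (pairing DA_over prods ?X ?X ?T (Idm DA_over ?X) (to_term DA_over prods ?X))) = Idm DA_over ?X"
      by (auto simp: compose_def fun_eq_iff)
  next
    have "?M (times DA_over prods ?T ?X ?X ?X i (\<lambda>x\<in>carrier B. x)
       (pairing DA_over prods ?X ?T ?X (to_term DA_over prods ?X) (\<lambda>x\<in>carrier B. x) b)) = b"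
      if b: "b \<in> carrier B" for b
    proof -
      obtain u where "u \<in> kernel" "b = i (\<phi> b) \<oplus>\<^bsub>B\<^esub> u" using b decomposeE by blast
      then show ?thesis
        using b Mv[of "\<phi> b" "\<zero>\<^bsub>B\<^esub>" u]
          by (simp add: tX(1) Tp(2)[simplified Term_prods, simplified]
            it(2)[simplified Term_prods, simplified] Term_prods)
    qed
    then show "Cmp DA_over ?X ?XX ?X ?M
       (Cmp DA_over ?X (Prod prods ?T ?X) ?XX (times DA_over prods ?T ?X ?X ?X i (Idm DA_over ?X))
         (pairing DA_over prods ?X ?T ?X (to_term DA_over prods ?X) (Idm DA_over ?X))) = Idm DA_over ?X"
      by (auto simp: compose_def fun_eq_iff)
  qed
qed

lemma monoid_objectD:
  assumes "monoid_object DA_over prods (B, \<phi>) M i"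
  shows "split_extension K lam A B \<phi> i" and "M = fibre_sum pr B \<phi> i"
proof -
  let ?X = "(B, \<phi>)" and ?T = "Term prods"
  let ?XX = "Prod prods ?X ?X"
  interpret mon: monoid_object DA_over prods ?X M i by fact
  interpret \<phi>: diff_algebra_hom K lam B A \<phi>
    using mon.X_in by (simp add: Ob_DA_over)
  interpret i: diff_algebra_hom K lam A B i
    using mon.unit_in by (simp add: Mor_DA_over Term_prods)
  interpret M: diff_algebra_hom K lam "fibre_product pr ?X ?X" B M
    using mon.mult_in by (simp add: Mor_DA_over)
  have sect [simp]: "\<phi> (i x) = x" if "x \<in> carrier A" for x
    using Mor_DA_over_apply[OF mon.unit_in, of x] that by (simp add: Term_prods)
  \<comment> \<open>Surjectivity is read off from the section first, because the elementwise
    formulas for \<open>pairing\<close> and \<open>times\<close>, and with them the unit axioms at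
    elements, depend on it.\<close>
  have X: "surjective_over ?X"
    using mon.X_in by (auto simp: surjective_over_def) (metis image_eqI i.hom_closed sect)
  note T = surjective_over_Term
  note XO = mon.X_in
  have id: "(\<lambda>x\<in>carrier B. x) \<in> Mor DA_over ?X ?X"
    using slice.Idm_in[OF XO] by simp
  note tX = to_term_DA_over[OF XO]
  note pT = pairing_DA_over[OF X T XO id tX(2)] and Tp = pairing_DA_over[OF T X XO tX(2) id]
    and ti = times_DA_over[OF X T X X id mon.unit_in] and it = times_DA_over[OF T X X X mon.unit_in id]
  have right: "M (pr (b, i (\<phi> b))) = b" if "b \<in> carrier B" for b
    using fun_cong[OF mon.mult_unit, of b] that
    by (simp add: tX(1) compose_def pT(2)[simplified Term_prods, simplified]
            ti(2)[simplified Term_prods, simplified] Term_prods)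
  have left: "M (pr (i (\<phi> b), b)) = b" if "b \<in> carrier B" for b
    using fun_cong[OF mon.unit_mult, of b] that
    by (simp add: tX(1) compose_def Tp(2)[simplified Term_prods, simplified]
            it(2)[simplified Term_prods, simplified] Term_prods)
  show "split_extension K lam A B \<phi> i"
  proof (unfold_locales, goal_cases)
    case (2 u v)
    have "M (pr (u, \<zero>\<^bsub>B\<^esub>) \<otimes>\<^bsub>fibre_product pr ?X ?X\<^esub> pr (\<zero>\<^bsub>B\<^esub>, v)) =
        M (pr (u, \<zero>\<^bsub>B\<^esub>)) \<otimes>\<^bsub>B\<^esub> M (pr (\<zero>\<^bsub>B\<^esub>, v))"
      using 2 by (intro M.mult) (simp_all add: \<phi>.hom_simps)
    \<comment> \<open>As \<open>\<phi> u\<close> and \<open>\<phi> v\<close> are zero, so are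
      \<open>i (\<phi> u)\<close> and \<open>i (\<phi> v)\<close>; thus \<open>right\<close> and
      \<open>left\<close> evaluate both factors.\<close>
    then show ?case
      using 2 right[of u] left[of v] right[of "\<zero>\<^bsub>B\<^esub>"] by (simp add: \<phi>.hom_simps i.hom_simps)
  qed simp
  then interpret split_extension K lam A B \<phi> i .
  show "M = fibre_sum pr B \<phi> i"
  proof
    fix z show "M z = fibre_sum pr B \<phi> i z"
    proof (cases "z \<in> carrier (fibre_product pr ?X ?X)")
      case True
      then obtain a b where z: "z = pr (a, b)" "a \<in> carrier B" "b \<in> carrier B" "\<phi> a = \<phi> b"
        by (auto elim: fibre_productE)
      \<comment> \<open>Both summands lie in the fibre product, the second because
        \<open>b - i (\<phi> b)\<close> is in the kernel. The second entries add up to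
        \<open>b\<close> because \<open>\<phi> a = \<phi> b\<close>.\<close>
      have "M (pr (a, i (\<phi> a)) \<oplus>\<^bsub>fibre_product pr ?X ?X\<^esub> pr (\<zero>\<^bsub>B\<^esub>, b \<ominus>\<^bsub>B\<^esub> i (\<phi> b))) =
        M (pr (a, i (\<phi> a))) \<oplus>\<^bsub>B\<^esub> M (pr (\<zero>\<^bsub>B\<^esub>, b \<ominus>\<^bsub>B\<^esub> i (\<phi> b)))"
        using z kernel_closed(8)[of b] by (intro M.hom_add) (simp_all add: \<phi>.hom_zero del: kernel_closed)
      then show ?thesis
        using z right[of a] left[of "b \<ominus>\<^bsub>B\<^esub> i (\<phi> b)"] kernel_closed(8)[of b] decompose[of b]
        by (simp add: fibre_sum_def i.hom_zero del: kernel_closed)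
    next
      case False
      then show ?thesis using M.ext by (simp add: extensional_def fibre_sum_def)
    qed
  qed
qed

section \<open>The category of monoid objects in terms of projections and sections\<close>

abbreviation "monoids_over \<equiv> monoids DA_over prods"

lemma Ob_monoids_over:
  "((B, \<phi>), M, i) \<in> Ob monoids_over \<longleftrightarrow> split_extension K lam A B \<phi> i \<and> M = fibre_sum pr B \<phi> i"
  using monoid_object_split_extension monoid_objectD by (fastforce simp: monoids_def)

lemma Cmp_monoids_over [simp]:
  "Cmp monoids_over ((B, \<phi>), M, i) Y Z g f = compose (carrier B) g f"
  by (cases Y; cases Z) (simp add: monoids_def)

lemma Idm_monoids_over [simp]: "Idm monoids_over ((B, \<phi>), M, i) = (\<lambda>x\<in>carrier B. x)"
  by (simp add: monoids_def)

text \<open>Compatibility with \<open>M\<close> is automatic: a homomorphism commuting with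
  projections and sections maps kernel to kernel, hence coordinates to coordinates, and being
  additive it preserves \<open>fibre_sum\<close>.\<close>

lemma Mor_monoids_over:
  assumes X: "((B, \<phi>), M, i) \<in> Ob monoids_over" and X': "((B', \<phi>'), M', i') \<in> Ob monoids_over"
  shows "f \<in> Mor monoids_over ((B, \<phi>), M, i) ((B', \<phi>'), M', i') \<longleftrightarrow>
    diff_algebra_hom K lam B B' f \<and> (\<forall>b\<in>carrier B. \<phi>' (f b) = \<phi> b) \<and> (\<forall>x\<in>carrier A. f (i x) = i' x)"
    (is "_ \<longleftrightarrow> ?R")
proof -
  have E: "split_extension K lam A B \<phi> i" and M: "M = fibre_sum pr B \<phi> i"
    and E': "split_extension K lam A B' \<phi>' i'" and M': "M' = fibre_sum pr B' \<phi>' i'"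
    using X X' by (simp_all add: Ob_monoids_over)
  interpret E: split_extension K lam A B \<phi> i by fact
  interpret E': split_extension K lam A B' \<phi>' i' by fact
  note S = split_extension_surjective[OF E] and S' = split_extension_surjective[OF E']
  show ?thesis
  proof
    assume f: "f \<in> Mor monoids_over ((B, \<phi>), M, i) ((B', \<phi>'), M', i')"
    then have fM: "f \<in> Mor DA_over (B, \<phi>) (B', \<phi>')" and "i' = compose (carrier A) f i"
      by (auto simp: monoids_def Term_prods)
    then have "f (i x) = i' x" if "x \<in> carrier A" for x
      using that by (simp add: compose_def)
    with Mor_DA_over_apply[OF fM] fM show ?R by (auto simp: Mor_DA_over)
  next
    assume R: ?R
    then interpret f: diff_algebra_hom K lam B B' f by simp
    have fM: "f \<in> Mor DA_over (B, \<phi>) (B', \<phi>')"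
      using R by (intro Mor_DA_overI surjective_over_Ob[OF S]) auto
    note t = times_DA_over[OF S S S' S' fM fM]
    have [simp]: "f u \<in> E'.kernel" if "u \<in> E.kernel" for u
      using E.kernelD[OF that] R f.hom_closed[of u] by (simp add: E'.kernel_def del: E'.kernelD)
    have "M' (times DA_over prods (B, \<phi>) (B, \<phi>) (B', \<phi>') (B', \<phi>') f f z) = f (M z)"
      if z: "z \<in> carrier (fibre_product pr (B, \<phi>) (B, \<phi>))" for z
    proof -
      obtain x u v where "x \<in> carrier A" "u \<in> E.kernel" "v \<in> E.kernel"
        "z = pr (i x \<oplus>\<^bsub>B\<^esub> u, i x \<oplus>\<^bsub>B\<^esub> v)"
        using E.fibre_productE_decomposed[OF z] by blast
      then show ?thesis
        using R by (simp add: t(2) M M' E.fibre_sum_decomposed[OF inj_pr]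
            E'.fibre_sum_decomposed[OF inj_pr] f.hom_add)
    qed
    moreover have "i' = compose (carrier A) f i"
      using R by (auto simp: compose_def fun_eq_iff intro: extensional_arb[OF E'.sec.ext])
    ultimately show "f \<in> Mor monoids_over ((B, \<phi>), M, i) ((B', \<phi>'), M', i')"
      using fM by (auto simp: monoids_def Term_prods compose_def fun_eq_iff)
  qed
qed

lemma category_monoids_over: "category monoids_over"
proof (unfold_locales, goal_cases)
  case (1 X)
  obtain B \<phi> M i where X: "X = ((B, \<phi>), M, i)" by (metis prod.exhaust)
  then interpret split_extension K lam A B \<phi> i using 1 by (simp add: Ob_monoids_over)
  show ?case
    using 1 by (simp add: X Mor_monoids_over proj.dom.id_hom)
next
  case (2 X Y Z f g)
  obtain B \<phi> M i B' \<phi>' M' i' B'' \<phi>'' M'' i''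
    where X: "X = ((B, \<phi>), M, i)" "Y = ((B', \<phi>'), M', i')" "Z = ((B'', \<phi>''), M'', i'')"
    by (metis prod.exhaust)
  interpret E: split_extension K lam A B \<phi> i using 2(1) by (simp add: X Ob_monoids_over)
  interpret f: diff_algebra_hom K lam B B' f using 2 by (simp add: X Mor_monoids_over)
  show ?case
    using 2 by (auto simp: X Mor_monoids_over compose_eq intro: diff_algebra_hom_compose)
next
  case (3 X Y f)
  then show ?case
    using slice.Cmp_Idm[of "fst X" "fst Y" f] by (auto simp: monoids_def monoid_object.X_in)
next
  case (4 X Y f)
  then show ?case
    using slice.Idm_Cmp[of "fst X" "fst Y" f] by (auto simp: monoids_def monoid_object.X_in)
next
  case (5 W X Y Z f g h)
  then show ?case
    using slice.Cmp_assoc[of "fst W" "fst X" "fst Y" "fst Z" f g h]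
    by (auto simp: monoids_def monoid_object.X_in)
qed

end


section \<open>Bimodules, kernels and semidirect products\<close>

context diff_bimodule
begin

lemmas add_simps [simp] = V.M.a_closed V.M.zero_closed V.M.a_inv_closed V.M.l_zero V.M.r_zero

lemma lact_closed [simp]: "\<lbrakk>x \<in> carrier A; v \<in> carrier V\<rbrakk> \<Longrightarrow> lact V x v \<in> carrier V"
  by (rule linear_on_closed[OF lact_linear])

lemma ract_closed [simp]: "\<lbrakk>x \<in> carrier A; v \<in> carrier V\<rbrakk> \<Longrightarrow> ract V v x \<in> carrier V"
  by (rule linear_on_closed[OF ract_linear])

lemma bder_closed [simp]: "v \<in> carrier V \<Longrightarrow> bder V v \<in> carrier V"
  by (rule linear_on_closed[OF bder_linear])

lemma act_add:
  "\<lbrakk>x \<in> carrier A; u \<in> carrier V; v \<in> carrier V\<rbrakk>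
    \<Longrightarrow> lact V x (u \<oplus>\<^bsub>V\<^esub> v) = lact V x u \<oplus>\<^bsub>V\<^esub> lact V x v"
  "\<lbrakk>x \<in> carrier A; y \<in> carrier A; v \<in> carrier V\<rbrakk>
    \<Longrightarrow> lact V (x \<oplus>\<^bsub>A\<^esub> y) v = lact V x v \<oplus>\<^bsub>V\<^esub> lact V y v"
  "\<lbrakk>x \<in> carrier A; u \<in> carrier V; v \<in> carrier V\<rbrakk>
    \<Longrightarrow> ract V (u \<oplus>\<^bsub>V\<^esub> v) x = ract V u x \<oplus>\<^bsub>V\<^esub> ract V v x"
  "\<lbrakk>x \<in> carrier A; y \<in> carrier A; v \<in> carrier V\<rbrakk>
    \<Longrightarrow> ract V v (x \<oplus>\<^bsub>A\<^esub> y) = ract V v x \<oplus>\<^bsub>V\<^esub> ract V v y"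
  by (rule linear_on_add[OF lact_linear] linear_on_add[OF lact_linear']
      linear_on_add[OF ract_linear] linear_on_add[OF ract_linear']; assumption)+

lemma act_smult:
  "\<lbrakk>c \<in> carrier K; x \<in> carrier A; v \<in> carrier V\<rbrakk>
    \<Longrightarrow> lact V x (c \<odot>\<^bsub>V\<^esub> v) = c \<odot>\<^bsub>V\<^esub> lact V x v"
  "\<lbrakk>c \<in> carrier K; x \<in> carrier A; v \<in> carrier V\<rbrakk>
    \<Longrightarrow> lact V (c \<odot>\<^bsub>A\<^esub> x) v = c \<odot>\<^bsub>V\<^esub> lact V x v"
  "\<lbrakk>c \<in> carrier K; x \<in> carrier A; v \<in> carrier V\<rbrakk>
    \<Longrightarrow> ract V (c \<odot>\<^bsub>V\<^esub> v) x = c \<odot>\<^bsub>V\<^esub> ract V v x"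
  "\<lbrakk>c \<in> carrier K; x \<in> carrier A; v \<in> carrier V\<rbrakk>
    \<Longrightarrow> ract V v (c \<odot>\<^bsub>A\<^esub> x) = c \<odot>\<^bsub>V\<^esub> ract V v x"
  by (rule linear_on_smult[OF lact_linear] linear_on_smult[OF lact_linear']
      linear_on_smult[OF ract_linear] linear_on_smult[OF ract_linear']; assumption)+

lemma act_zero [simp]:
  "x \<in> carrier A \<Longrightarrow> lact V x \<zero>\<^bsub>V\<^esub> = \<zero>\<^bsub>V\<^esub>"
  "v \<in> carrier V \<Longrightarrow> lact V \<zero>\<^bsub>A\<^esub> v = \<zero>\<^bsub>V\<^esub>"
  "x \<in> carrier A \<Longrightarrow> ract V \<zero>\<^bsub>V\<^esub> x = \<zero>\<^bsub>V\<^esub>"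
  "v \<in> carrier V \<Longrightarrow> ract V v \<zero>\<^bsub>A\<^esub> = \<zero>\<^bsub>V\<^esub>"
  by (rule linear_on_zero[OF V.M.abelian_group_axioms V.M.abelian_group_axioms lact_linear]
      linear_on_zero[OF alg.M.abelian_group_axioms V.M.abelian_group_axioms lact_linear']
      linear_on_zero[OF V.M.abelian_group_axioms V.M.abelian_group_axioms ract_linear]
      linear_on_zero[OF alg.M.abelian_group_axioms V.M.abelian_group_axioms ract_linear']; assumption)+

lemma bder_add:
  "\<lbrakk>u \<in> carrier V; v \<in> carrier V\<rbrakk> \<Longrightarrow> bder V (u \<oplus>\<^bsub>V\<^esub> v) = bder V u \<oplus>\<^bsub>V\<^esub> bder V v"
  by (rule linear_on_add[OF bder_linear])

lemma bder_smult:
  "\<lbrakk>c \<in> carrier K; v \<in> carrier V\<rbrakk> \<Longrightarrow> bder V (c \<odot>\<^bsub>V\<^esub> v) = c \<odot>\<^bsub>V\<^esub> bder V v"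
  by (rule linear_on_smult[OF bder_linear])

lemma bder_zero [simp]: "bder V \<zero>\<^bsub>V\<^esub> = \<zero>\<^bsub>V\<^esub>"
  by (rule linear_on_zero[OF V.M.abelian_group_axioms V.M.abelian_group_axioms bder_linear])

lemma id_hom: "diff_bimodule_hom K lam A V V (\<lambda>v\<in>carrier V. v)"
  by unfold_locales (auto intro!: linear_onI)

end

lemma diff_bimodule_homI:
  assumes "diff_bimodule K lam A V" "diff_bimodule K lam A W" "f \<in> extensional (carrier V)"
    and "\<And>v. v \<in> carrier V \<Longrightarrow> f v \<in> carrier W"
    and "\<And>u v. \<lbrakk>u \<in> carrier V; v \<in> carrier V\<rbrakk> \<Longrightarrow> f (u \<oplus>\<^bsub>V\<^esub> v) = f u \<oplus>\<^bsub>W\<^esub> f v"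
    and "\<And>c v. \<lbrakk>c \<in> carrier K; v \<in> carrier V\<rbrakk> \<Longrightarrow> f (c \<odot>\<^bsub>V\<^esub> v) = c \<odot>\<^bsub>W\<^esub> f v"
    and "\<And>x v. \<lbrakk>x \<in> carrier A; v \<in> carrier V\<rbrakk> \<Longrightarrow> f (lact V x v) = lact W x (f v)"
    and "\<And>x v. \<lbrakk>x \<in> carrier A; v \<in> carrier V\<rbrakk> \<Longrightarrow> f (ract V v x) = ract W (f v) x"
    and "\<And>v. v \<in> carrier V \<Longrightarrow> f (bder V v) = bder W (f v)"
  shows "diff_bimodule_hom K lam A V W f"
  by (intro diff_bimodule_hom.intro diff_bimodule_hom_axioms.intro linear_onI assms)

context diff_bimodule_hom
begin

lemma hom_closed [simp]: "v \<in> carrier V \<Longrightarrow> f v \<in> carrier W"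
  by (rule linear_on_closed[OF linear])

lemma hom_add: "\<lbrakk>u \<in> carrier V; v \<in> carrier V\<rbrakk> \<Longrightarrow> f (u \<oplus>\<^bsub>V\<^esub> v) = f u \<oplus>\<^bsub>W\<^esub> f v"
  by (rule linear_on_add[OF linear])

lemma hom_smult: "\<lbrakk>c \<in> carrier K; v \<in> carrier V\<rbrakk> \<Longrightarrow> f (c \<odot>\<^bsub>V\<^esub> v) = c \<odot>\<^bsub>W\<^esub> f v"
  by (rule linear_on_smult[OF linear])

lemma hom_zero: "f \<zero>\<^bsub>V\<^esub> = \<zero>\<^bsub>W\<^esub>"
  by (rule linear_on_zero[OF dom.V.M.abelian_group_axioms cod.V.M.abelian_group_axioms linear])

lemmas hom_simps = hom_add hom_smult hom_zero lact ract bder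

end

lemma diff_bimodule_hom_compose:
  assumes "diff_bimodule_hom K lam A U V f" "diff_bimodule_hom K lam A V W g"
  shows "diff_bimodule_hom K lam A U W (compose (carrier U) g f)"
proof -
  interpret f: diff_bimodule_hom K lam A U V f by fact
  interpret g: diff_bimodule_hom K lam A V W g by fact
  show ?thesis
    by (intro diff_bimodule_homI f.dom.diff_bimodule_axioms g.cod.diff_bimodule_axioms)
      (auto simp: compose_def f.hom_simps g.hom_simps)
qed

lemma category_Bimod: "category (Bimod K lam A)"
proof (unfold_locales, goal_cases)
  case (3 X Y f)
  then interpret diff_bimodule_hom K lam A X Y f by (simp add: Bimod_def)
  show ?case by (auto simp: Bimod_def compose_def fun_eq_iff intro: extensional_arb[OF ext, symmetric])
next
  case (4 X Y f)
  then interpret diff_bimodule_hom K lam A X Y f by (simp add: Bimod_def)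
  show ?case by (auto simp: Bimod_def compose_def fun_eq_iff intro: extensional_arb[OF ext, symmetric])
next
  case (5 W X Y Z f g h)
  then interpret diff_bimodule_hom K lam A W X f by (simp add: Bimod_def)
  show ?case by (auto simp: Bimod_def compose_def fun_eq_iff)
qed (auto simp: Bimod_def intro: diff_bimodule.id_hom diff_bimodule_hom_compose)

text \<open>Each operation is applied to values of \<open>g\<close>, mapped by \<open>f\<close>, and
  pulled back by \<open>gf\<close>. This leaves only set-theoretic conditions to check for an
  inverse.\<close>

lemma diff_algebra_hom_inverse:
  assumes "diff_algebra_hom K lam A B f" "g \<in> extensional (carrier B)"
    and g: "\<And>y. y \<in> carrier B \<Longrightarrow> g y \<in> carrier A" and gf: "\<And>x. x \<in> carrier A \<Longrightarrow> g (f x) = x"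
    and fg: "\<And>y. y \<in> carrier B \<Longrightarrow> f (g y) = y"
  shows "diff_algebra_hom K lam B A g"
proof -
  interpret f: diff_algebra_hom K lam A B f by fact
  show ?thesis
  proof (intro diff_algebra_homI assms(2) g f.dom.diff_algebra_axioms f.cod.diff_algebra_axioms, goal_cases)
    case (2 x y)
    then show ?case using gf[of "g x \<oplus>\<^bsub>A\<^esub> g y"] by (simp add: f.hom_simps g fg)
  next
    case (3 c x)
    then show ?case using gf[of "c \<odot>\<^bsub>A\<^esub> g x"] by (simp add: f.hom_simps g fg)
  next
    case (4 x y)
    then show ?case using gf[of "g x \<otimes>\<^bsub>A\<^esub> g y"] by (simp add: f.hom_simps g fg)
  next
    case (5 x)
    then show ?case using gf[of "der A (g x)"] by (simp add: f.hom_simps g fg)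
  qed simp
qed

lemma diff_bimodule_hom_inverse:
  assumes "diff_bimodule_hom K lam A V W f" "g \<in> extensional (carrier W)"
    and g: "\<And>y. y \<in> carrier W \<Longrightarrow> g y \<in> carrier V" and gf: "\<And>x. x \<in> carrier V \<Longrightarrow> g (f x) = x"
    and fg: "\<And>y. y \<in> carrier W \<Longrightarrow> f (g y) = y"
  shows "diff_bimodule_hom K lam A W V g"
proof -
  interpret f: diff_bimodule_hom K lam A V W f by fact
  show ?thesis
  proof (intro diff_bimodule_homI assms(2) g f.dom.diff_bimodule_axioms f.cod.diff_bimodule_axioms, goal_cases)
    case (2 u v)
    then show ?case using gf[of "g u \<oplus>\<^bsub>V\<^esub> g v"] by (simp add: f.hom_simps g fg)
  next
    case (3 c v)
    then show ?case using gf[of "c \<odot>\<^bsub>V\<^esub> g v"] by (simp add: f.hom_simps g fg)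
  next
    case (4 x v)
    then show ?case using gf[of "lact V x (g v)"] by (simp add: f.hom_simps g fg)
  next
    case (5 x v)
    then show ?case using gf[of "ract V (g v) x"] by (simp add: f.hom_simps g fg)
  next
    case (6 v)
    then show ?case using gf[of "bder V (g v)"] by (simp add: f.hom_simps g fg)
  qed simp
qed

section \<open>The kernel of a split extension as a bimodule\<close>

context split_extension
begin

lemma ker_bimod_simps:
  "carrier (ker_bimod A ((B, \<phi>), M, i)) = kernel"
  "u \<oplus>\<^bsub>ker_bimod A ((B, \<phi>), M, i)\<^esub> v = u \<oplus>\<^bsub>B\<^esub> v"
  "\<zero>\<^bsub>ker_bimod A ((B, \<phi>), M, i)\<^esub> = \<zero>\<^bsub>B\<^esub>"
  "c \<odot>\<^bsub>ker_bimod A ((B, \<phi>), M, i)\<^esub> v = c \<odot>\<^bsub>B\<^esub> v"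
  "lact (ker_bimod A ((B, \<phi>), M, i)) x v = i x \<otimes>\<^bsub>B\<^esub> v"
  "ract (ker_bimod A ((B, \<phi>), M, i)) v x = v \<otimes>\<^bsub>B\<^esub> i x"
  "bder (ker_bimod A ((B, \<phi>), M, i)) v = der B v"
  by (simp_all add: ker_bimod_def kernel_def del: kernelD)

text \<open>Each law for the actions is a law of \<open>B\<close> with the acting factors in the
  image of \<open>i\<close>. The two rules for \<open>bder\<close> are \<open>der_mult\<close> in
  \<open>B\<close>, rewritten by the fact that \<open>i\<close> commutes with the operators.\<close>

lemma ker_bimod_diff_bimodule:
  assumes "lam \<in> carrier K"
  shows "diff_bimodule K lam A (ker_bimod A ((B, \<phi>), M, i))"
proof -
  note [simp] = ker_bimod_simps assms
  have "module K (ker_bimod A ((B, \<phi>), M, i))"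
  proof (intro moduleI abelian_groupI proj.dom.R.cring_axioms, goal_cases)
    case (6 v)
    then show ?case by (intro bexI[of _ "\<ominus>\<^bsub>B\<^esub> v"]) (simp_all add: proj.dom.M.l_neg)
  qed (simp_all add: proj.dom.M.a_ac proj.dom.smult_l_distr proj.dom.smult_r_distr
      proj.dom.smult_assoc1)
  then interpret V: module K "ker_bimod A ((B, \<phi>), M, i)" .
  show ?thesis
    by unfold_locales
      (auto intro!: linear_onI simp: proj.dom.mult_add_left proj.dom.mult_add_right
        proj.dom.mult_smult_left proj.dom.mult_smult_right proj.dom.mult_assoc sec.hom_simps
        proj.dom.der_add proj.dom.der_smult proj.dom.der_mult proj.dom.M.a_ac)
qed

end

section \<open>The semidirect product as a split extension\<close>

lemma carrier_semidirect: "carrier (semidirect pr A V) = pr ` (carrier A \<times> carrier V)"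
  by (simp add: semidirect_def)

lemma semidirectE:
  assumes "z \<in> carrier (semidirect pr A V)"
  obtains x u where "z = pr (x, u)" "x \<in> carrier A" "u \<in> carrier V"
  using assms by (auto simp: carrier_semidirect)

lemma semidirect_simps:
  assumes "inj pr"
  shows "pr (x, u) \<in> carrier (semidirect pr A V) \<longleftrightarrow> x \<in> carrier A \<and> u \<in> carrier V"
    and "pr (x, u) \<oplus>\<^bsub>semidirect pr A V\<^esub> pr (y, v) = pr (x \<oplus>\<^bsub>A\<^esub> y, u \<oplus>\<^bsub>V\<^esub> v)"
    and "pr (x, u) \<otimes>\<^bsub>semidirect pr A V\<^esub> pr (y, v) = pr (x \<otimes>\<^bsub>A\<^esub> y, lact V x v \<oplus>\<^bsub>V\<^esub> ract V u y)"
    and "c \<odot>\<^bsub>semidirect pr A V\<^esub> pr (x, u) = pr (c \<odot>\<^bsub>A\<^esub> x, c \<odot>\<^bsub>V\<^esub> u)"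
    and "\<zero>\<^bsub>semidirect pr A V\<^esub> = pr (\<zero>\<^bsub>A\<^esub>, \<zero>\<^bsub>V\<^esub>)"
    and "der (semidirect pr A V) (pr (x, u)) = pr (der A x, bder V u)"
  using assms by (auto simp: semidirect_def inj_eq)

lemma semidirect_diff_algebra:
  assumes pr: "inj pr" and lam: "lam \<in> carrier K" and "diff_bimodule K lam A V"
  shows "diff_algebra K lam (semidirect pr A V)"
proof -
  interpret diff_bimodule K lam A V by fact
  note [simp] = semidirect_simps[OF pr] inj_eq[OF pr] lam
  have module: "module K (semidirect pr A V)"
  proof (intro moduleI abelian_groupI alg.R.cring_axioms, goal_cases)
    case (6 z)
    then obtain x u where "z = pr (x, u)" "x \<in> carrier A" "u \<in> carrier V"
      by (elim semidirectE)
    then show ?case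
      by (intro bexI[of _ "pr (\<ominus>\<^bsub>A\<^esub> x, \<ominus>\<^bsub>V\<^esub> u)"]) (auto simp: alg.M.l_neg V.M.l_neg)
  qed (auto elim!: semidirectE simp: alg.M.a_ac V.M.a_ac alg.smult_l_distr V.smult_l_distr
      alg.smult_r_distr V.smult_r_distr alg.smult_assoc1 V.smult_assoc1)
  show ?thesis
  proof (intro diff_algebraI module, goal_cases)
    \<comment> \<open>This is the clause \<open>der_unit\<close>, the last premise of
      \<open>diff_algebraI\<close>; its first premise has been discharged by
      \<open>module\<close>.\<close>
    case (11 e)
    then obtain x u where e: "e = pr (x, u)" "x \<in> carrier A" "u \<in> carrier V"
      by (elim semidirectE)
    have unit: "x \<otimes>\<^bsub>A\<^esub> y = y \<and> y \<otimes>\<^bsub>A\<^esub> x = y \<and> lact V x v \<oplus>\<^bsub>V\<^esub> ract V u y = v"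
      if "y \<in> carrier A" "v \<in> carrier V" for y v
      using 11(2)[of "pr (y, v)"] that e by simp
    \<comment> \<open>Multiplying \<open>(0, u)\<close> by \<open>e = (x, u)\<close> from the left
      gives \<open>x u = u\<close>, whereas \<open>(x, 0) e = (x, 0)\<close> gives
      \<open>x u = 0\<close>. Hence \<open>u = 0\<close>, and the first component is an identity of
      \<open>A\<close>, to which the clause for \<open>A\<close> applies.\<close>
    have "lact V x u = u" using unit[of "\<zero>\<^bsub>A\<^esub>" u] e by simp
    then have "u = \<zero>\<^bsub>V\<^esub>"
      using 11(2)[of "pr (x, \<zero>\<^bsub>V\<^esub>)"] e by simp
    moreover have "der A x = \<zero>\<^bsub>A\<^esub>"
      using e unit[of _ "\<zero>\<^bsub>V\<^esub>"] by (intro alg.der_unit) auto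
    ultimately show ?case by (simp add: e)
  qed (auto elim!: semidirectE simp: alg.mult_add_right alg.mult_add_left alg.mult_smult_right
      alg.mult_smult_left alg.mult_assoc alg.der_add alg.der_smult alg.der_mult act_add act_smult
      lact_mult ract_mult lact_ract bder_add bder_smult bder_lact bder_ract V.smult_r_distr V.M.a_ac)
qed

lemma semidirect_split_extension:
  assumes pr: "inj pr" and lam: "lam \<in> carrier K" and V: "diff_bimodule K lam A V"
  shows "split_extension K lam A (semidirect pr A V)
    (\<lambda>z\<in>carrier (semidirect pr A V). fst (unpair pr z)) (\<lambda>x\<in>carrier A. pr (x, \<zero>\<^bsub>V\<^esub>))"
proof -
  interpret diff_bimodule K lam A V by fact
  interpret S: diff_algebra K lam "semidirect pr A V"
    by (rule semidirect_diff_algebra) fact+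
  note [simp] = semidirect_simps[OF pr] inj_eq[OF pr] unpair_pr[OF pr]
  show ?thesis
  proof (intro split_extension.intro split_extension_axioms.intro diff_algebra_homI
      S.diff_algebra_axioms alg.diff_algebra_axioms, goal_cases)
    \<comment> \<open>Elements of the kernel have the form \<open>(0, u)\<close>, and
      \<open>0\<close> acts as zero from either side.\<close>
    case (14 u v)
    then show ?case by (auto elim!: semidirectE)
  qed (auto elim!: semidirectE)
qed

text \<open>The multiplication \<open>(x, u), (x, v) |-> (x, u + v)\<close> is brought into the form
  \<open>fibre_sum\<close>, so that the general description of monoid objects and their morphisms
  applies to the semidirect product.\<close>

lemma semidirect_monoid_eq:
  assumes pr: "inj pr" and lam: "lam \<in> carrier K" and V: "diff_bimodule K lam A V"
  shows "semidirect_monoid pr A V =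
    ((semidirect pr A V, \<lambda>z\<in>carrier (semidirect pr A V). fst (unpair pr z)),
      fibre_sum pr (semidirect pr A V) (\<lambda>z\<in>carrier (semidirect pr A V). fst (unpair pr z))
        (\<lambda>x\<in>carrier A. pr (x, \<zero>\<^bsub>V\<^esub>)),
      \<lambda>x\<in>carrier A. pr (x, \<zero>\<^bsub>V\<^esub>))"
proof -
  let ?S = "semidirect pr A V"
  let ?p = "\<lambda>z\<in>carrier ?S. fst (unpair pr z)" and ?i = "\<lambda>x\<in>carrier A. pr (x, \<zero>\<^bsub>V\<^esub>)"
  interpret diff_bimodule K lam A V by fact
  interpret E: split_extension K lam A ?S ?p ?i
    by (rule semidirect_split_extension) fact+
  note [simp] = semidirect_simps[OF pr] inj_eq[OF pr] unpair_pr[OF pr]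
  have sum: "pr (x, u \<oplus>\<^bsub>V\<^esub> v) = fibre_sum pr ?S ?p ?i (pr (pr (x, u), pr (x, v)))"
    if "x \<in> carrier A" "u \<in> carrier V" "v \<in> carrier V" for x u v
    \<comment> \<open>The coordinates of \<open>(x, u)\<close> in this extension are
      \<open>x\<close> and \<open>(0, u)\<close>, since
      \<open>(x, u) = (x, 0) + (0, u)\<close>.\<close>
    using that E.fibre_sum_decomposed[OF pr, of x "pr (\<zero>\<^bsub>A\<^esub>, u)" "pr (\<zero>\<^bsub>A\<^esub>, v)"]
    by (simp add: E.kernel_def del: E.kernelD)
  have "(\<lambda>z\<in>carrier (fibre_product pr (?S, ?p) (?S, ?p)).
         let (a, b) = unpair pr z; (x, u) = unpair pr a; (_, v) = unpair pr b in pr (x, u \<oplus>\<^bsub>V\<^esub> v)) =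
      fibre_sum pr ?S ?p ?i" (is "?f = _")
  proof (intro ext)
    fix z
    show "?f z = fibre_sum pr ?S ?p ?i z"
    proof (cases "z \<in> carrier (fibre_product pr (?S, ?p) (?S, ?p))")
      case True
      then show ?thesis
        by (auto elim!: fibre_productE semidirectE simp: fibre_product_simps[OF pr] sum)
    qed (simp add: fibre_sum_def)
  qed
  then show ?thesis
    by (simp add: semidirect_monoid_def semidirect_over_def)
qed


section \<open>The equivalence\<close>

context diff_slice
begin

lemma Ob_monoids_overE:
  assumes "X \<in> Ob monoids_over"
  obtains B \<phi> i where "X = ((B, \<phi>), fibre_sum pr B \<phi> i, i)" "split_extension K lam A B \<phi> i"
  using assms by (cases X) (auto simp: Ob_monoids_over)

section \<open>Functoriality of the kernel and of the semidirect product\<close>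

lemma ker_func_is_functor: "is_functor monoids_over (Bimod K lam A) (ker_func A)"
proof (intro is_functor.intro category_monoids_over category_Bimod is_functor_axioms.intro, goal_cases)
  case (1 X)
  then obtain B \<phi> i where X: "X = ((B, \<phi>), fibre_sum pr B \<phi> i, i)" "split_extension K lam A B \<phi> i"
    by (rule Ob_monoids_overE)
  then show ?case
    by (auto simp: ker_func_def Bimod_def intro: split_extension.ker_bimod_diff_bimodule)
next
  case (2 X Y f)
  obtain B \<phi> i where X: "X = ((B, \<phi>), fibre_sum pr B \<phi> i, i)" "split_extension K lam A B \<phi> i"
    using 2(1) by (rule Ob_monoids_overE)
  obtain B' \<phi>' i' where Y: "Y = ((B', \<phi>'), fibre_sum pr B' \<phi>' i', i')" "split_extension K lam A B' \<phi>' i'"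
    using 2(2) by (rule Ob_monoids_overE)
  interpret X: split_extension K lam A B \<phi> i by fact
  interpret Y: split_extension K lam A B' \<phi>' i' by fact
  have f: "diff_algebra_hom K lam B B' f" "b \<in> carrier B \<Longrightarrow> \<phi>' (f b) = \<phi> b"
    "x \<in> carrier A \<Longrightarrow> f (i x) = i' x" for b x
    using 2 by (simp_all add: X Y Mor_monoids_over)
  interpret f: diff_algebra_hom K lam B B' f by fact
  have ker: "f u \<in> Y.kernel" if "u \<in> X.kernel" for u
    using X.kernelD[OF that] f(2)[of u] f.hom_closed[of u] by (simp add: Y.kernel_def del: Y.kernelD)
  have "diff_bimodule_hom K lam A (ker_bimod A X) (ker_bimod A Y) (restrict f X.kernel)"
    unfolding X(1) Y(1)
    by (intro diff_bimodule_homI X.ker_bimod_diff_bimodule Y.ker_bimod_diff_bimodule)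
      (simp_all add: X.ker_bimod_simps Y.ker_bimod_simps ker f.hom_simps f(3))
  then show ?case
    by (simp add: ker_func_def Bimod_def X(1) X.ker_bimod_simps)
next
  case (3 X)
  then obtain B \<phi> i where X: "X = ((B, \<phi>), fibre_sum pr B \<phi> i, i)" "split_extension K lam A B \<phi> i"
    by (rule Ob_monoids_overE)
  interpret X: split_extension K lam A B \<phi> i by fact
  show ?case by (auto simp: ker_func_def Bimod_def X(1) X.ker_bimod_simps fun_eq_iff)
next
  case (4 X Y Z f g)
  obtain B \<phi> i where X: "X = ((B, \<phi>), fibre_sum pr B \<phi> i, i)" "split_extension K lam A B \<phi> i"
    using 4(1) by (rule Ob_monoids_overE)
  obtain B' \<phi>' i' where Y: "Y = ((B', \<phi>'), fibre_sum pr B' \<phi>' i', i')" "split_extension K lam A B' \<phi>' i'"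
    using 4(2) by (rule Ob_monoids_overE)
  interpret X: split_extension K lam A B \<phi> i by fact
  interpret Y: split_extension K lam A B' \<phi>' i' by fact
  interpret f: diff_algebra_hom K lam B B' f using 4 by (simp add: X Y Mor_monoids_over)
  \<comment> \<open>The restriction of \<open>g\<close> is \<open>undefined\<close> off the kernel
    of \<open>\<phi>'\<close>, so restricting commutes with composition only because
    \<open>f\<close> maps into that kernel.\<close>
  have "f u \<in> Y.kernel" if "u \<in> X.kernel" for u
    using 4 X.kernelD[OF that] f.hom_closed[of u]
    by (simp add: X Y Mor_monoids_over Y.kernel_def del: Y.kernelD)
  then show ?case
    by (auto simp: ker_func_def Bimod_def X(1) Y(1) X.ker_bimod_simps Y.ker_bimod_simps
        fun_eq_iff compose_def)
qed

lemma Ob_semidirect: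
  assumes "diff_bimodule K lam A V"
  shows "semidirect_monoid pr A V \<in> Ob monoids_over"
  using semidirect_split_extension[OF inj_pr lam_closed assms]
  by (simp add: semidirect_monoid_eq[OF inj_pr lam_closed assms] Ob_monoids_over)

lemma Cmp_semidirect:
  "Cmp monoids_over (semidirect_monoid pr A V) Y Z g f = compose (carrier (semidirect pr A V)) g f"
  and Idm_semidirect: "Idm monoids_over (semidirect_monoid pr A V) = (\<lambda>z\<in>carrier (semidirect pr A V). z)"
  by (simp_all add: semidirect_monoid_def semidirect_over_def Let_def)

text \<open>Serves twice: for the action of the semidirect functor on morphisms and for the map
  \<open>decomposition\<close>.\<close>

lemma Mor_into_semidirect:
  assumes X: "((B, \<phi>), M, i) \<in> Ob monoids_over" and V: "diff_bimodule K lam A V"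
    and f: "diff_algebra_hom K lam B (semidirect pr A V) f"
    and "\<And>b. b \<in> carrier B \<Longrightarrow> fst (unpair pr (f b)) = \<phi> b"
    and "\<And>x. x \<in> carrier A \<Longrightarrow> f (i x) = pr (x, \<zero>\<^bsub>V\<^esub>)"
  shows "f \<in> Mor monoids_over ((B, \<phi>), M, i) (semidirect_monoid pr A V)"
proof -
  interpret f: diff_algebra_hom K lam B "semidirect pr A V" f by fact
  show ?thesis
    using assms Ob_semidirect[OF V]
    by (simp add: Mor_monoids_over semidirect_monoid_eq[OF inj_pr lam_closed V])
qed

lemmas sd_simps [simp] = semidirect_simps[OF inj_pr]

lemma semidirect_func_is_functor: "is_functor (Bimod K lam A) monoids_over (semidirect_func pr A)"
proof (intro is_functor.intro category_monoids_over category_Bimod is_functor_axioms.intro, goal_cases)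
  case (1 V)
  then show ?case by (simp add: semidirect_func_def Bimod_def Ob_semidirect)
next
  case (2 V W f)
  then have V: "diff_bimodule K lam A V" and W: "diff_bimodule K lam A W"
    by (simp_all add: Bimod_def)
  interpret f: diff_bimodule_hom K lam A V W f using 2 by (simp add: Bimod_def)
  note SV = semidirect_diff_algebra[OF inj_pr lam_closed V]
    and SW = semidirect_diff_algebra[OF inj_pr lam_closed W]
  let ?F = "\<lambda>z\<in>carrier (semidirect pr A V). let (x, u) = unpair pr z in pr (x, f u)"
  interpret SV: diff_algebra K lam "semidirect pr A V" by (rule SV)
  have F: "diff_algebra_hom K lam (semidirect pr A V) (semidirect pr A W) ?F"
    by (intro diff_algebra_homI SV SW) (auto elim!: semidirectE simp: f.hom_simps)
  have "?F \<in> Mor monoids_over (semidirect_monoid pr A V) (semidirect_monoid pr A W)"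
    using Ob_semidirect[OF V] unfolding semidirect_monoid_eq[OF inj_pr lam_closed V]
    by (intro Mor_into_semidirect W F) (auto elim!: semidirectE simp: f.hom_simps)
  then show ?case by (simp add: semidirect_func_def)
next
  case (3 V)
  then show ?case
    by (auto simp: semidirect_func_def Idm_semidirect Bimod_def fun_eq_iff elim!: semidirectE)
next
  case (4 U V W f g)
  interpret f: diff_bimodule_hom K lam A U V f using 4 by (simp add: Bimod_def)
  show ?case
    by (auto simp: semidirect_func_def Cmp_semidirect Bimod_def fun_eq_iff compose_def elim!: semidirectE)
qed

section \<open>The natural isomorphism from a monoid object to the semidirect product with its
  kernel\<close>

lemma monoids_over_isoI:
  assumes X: "((B, \<phi>), M, i) \<in> Ob monoids_over" and Y: "((B', \<phi>'), M', i') \<in> Ob monoids_over"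
    and f: "f \<in> Mor monoids_over ((B, \<phi>), M, i) ((B', \<phi>'), M', i')"
    and g: "\<And>b. b \<in> carrier B' \<Longrightarrow> g b \<in> carrier B"
    and gf: "\<And>b. b \<in> carrier B \<Longrightarrow> g (f b) = b" and fg: "\<And>b. b \<in> carrier B' \<Longrightarrow> f (g b) = b"
  shows "is_iso monoids_over ((B, \<phi>), M, i) ((B', \<phi>'), M', i') f"
proof -
  let ?g = "restrict g (carrier B')"
  have fh: "diff_algebra_hom K lam B B' f" and f\<phi>: "\<And>b. b \<in> carrier B \<Longrightarrow> \<phi>' (f b) = \<phi> b"
    and fi: "\<And>x. x \<in> carrier A \<Longrightarrow> f (i x) = i' x"
    using f by (simp_all add: Mor_monoids_over[OF X Y])
  interpret f: diff_algebra_hom K lam B B' f by (rule fh)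
  interpret E: split_extension K lam A B \<phi> i using X by (simp add: Ob_monoids_over)
  interpret E': split_extension K lam A B' \<phi>' i' using Y by (simp add: Ob_monoids_over)
  have "diff_algebra_hom K lam B' B ?g"
    by (rule diff_algebra_hom_inverse[OF fh]) (simp_all add: g gf fg)
  \<comment> \<open>Compatibility of the inverse with projections and sections comes from that of
    \<open>f\<close>, evaluated at \<open>g b\<close> and at \<open>i x\<close>.\<close>
  moreover have "\<phi> (g b) = \<phi>' b" if "b \<in> carrier B'" for b
    using f\<phi>[of "g b"] that by (simp add: g fg)
  moreover have "g (i' x) = i x" if "x \<in> carrier A" for x
    using gf[of "i x"] that by (simp add: fi)
  ultimately have "?g \<in> Mor monoids_over ((B', \<phi>'), M', i') ((B, \<phi>), M, i)"
    by (simp add: Mor_monoids_over[OF Y X])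
  moreover have "compose (carrier B) ?g f = (\<lambda>x\<in>carrier B. x)"
    "compose (carrier B') f ?g = (\<lambda>x\<in>carrier B'. x)"
    by (auto simp: compose_def fun_eq_iff gf fg)
  ultimately show ?thesis using f by (auto simp: is_iso_def)
qed

definition decomposition :: "('k, 'u) slice_monoid \<Rightarrow> 'u \<Rightarrow> 'u" where
  "decomposition = (\<lambda>((B, \<phi>), M, i). \<lambda>b\<in>carrier B. pr (\<phi> b, b \<ominus>\<^bsub>B\<^esub> i (\<phi> b)))"

text \<open>The rules \<open>decomposed_simps\<close> for \<open>B\<close> have the same shape as
  the operations of the semidirect product, so in coordinates the homomorphism property is
  rewriting. The inverse reassembles \<open>i x + u\<close> from \<open>(x, u)\<close>.\<close>

lemma decomposition_iso:
  assumes "split_extension K lam A B \<phi> i" and X: "X = ((B, \<phi>), fibre_sum pr B \<phi> i, i)"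
  shows "is_iso monoids_over X (semidirect_monoid pr A (ker_bimod A X)) (decomposition X)"
proof -
  interpret split_extension K lam A B \<phi> i by fact
  let ?V = "ker_bimod A X"
  let ?f = "decomposition X"
  let ?g = "\<lambda>z. let (x, u) = unpair pr z in i x \<oplus>\<^bsub>B\<^esub> u"
  note V = ker_bimod_diff_bimodule[OF lam_closed, of "fibre_sum pr B \<phi> i", folded X]
  note Vs [simp] = ker_bimod_simps[of "fibre_sum pr B \<phi> i", folded X]
  have XO: "((B, \<phi>), fibre_sum pr B \<phi> i, i) \<in> Ob monoids_over"
    using assms by (simp add: Ob_monoids_over)
  have fv: "?f (i x \<oplus>\<^bsub>B\<^esub> u) = pr (x, u)" if "x \<in> carrier A" "u \<in> kernel" for x u
    using that by (simp add: decomposition_def X)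
  have fi: "?f (i x) = pr (x, \<zero>\<^bsub>B\<^esub>)" if "x \<in> carrier A" for x
    using fv[of x "\<zero>\<^bsub>B\<^esub>"] that by simp
  have gc: "?g z \<in> carrier B" if "z \<in> carrier (semidirect pr A ?V)" for z
    using that by (auto elim!: semidirectE)
  have fg: "?f (?g z) = z" if "z \<in> carrier (semidirect pr A ?V)" for z
    using that by (auto elim!: semidirectE simp: fv)
  have gf: "?g (?f b) = b" if b: "b \<in> carrier B" for b
    using b decompose[OF b] by (simp add: decomposition_def X)
  have dec: "\<exists>x u. x \<in> carrier A \<and> u \<in> kernel \<and> b = i x \<oplus>\<^bsub>B\<^esub> u" if "b \<in> carrier B" for b
    using that by (meson decomposeE proj.hom_closed)
  have "diff_algebra_hom K lam B (semidirect pr A ?V) ?f"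
  proof (intro diff_algebra_homI semidirect_diff_algebra inj_pr lam_closed V
      proj.dom.diff_algebra_axioms, goal_cases)
    case 1 show ?case by (simp add: decomposition_def X)
  qed (auto dest!: dec simp: fv decomposed_simps)
  then have f: "?f \<in> Mor monoids_over ((B, \<phi>), fibre_sum pr B \<phi> i, i) (semidirect_monoid pr A ?V)"
    by (intro Mor_into_semidirect XO V) (simp_all add: fi, simp add: decomposition_def X)
  show ?thesis
    using Ob_semidirect[OF V] f gc gf fg XO
    unfolding X semidirect_monoid_eq[OF inj_pr lam_closed V[unfolded X]]
    by (intro monoids_over_isoI[where g = ?g]) auto
qed

text \<open>Naturality amounts to \<open>f (b - i (\<phi> b)) = f b - i' (\<phi>' (f b))\<close>,
  which holds because \<open>f\<close> is additive and commutes with projections and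
  sections.\<close>

lemma decomposition_natural:
  "natural_iso monoids_over monoids_over id_func (comp_func (semidirect_func pr A) (ker_func A)) decomposition"
  unfolding natural_iso_def
proof (intro conjI ballI)
  fix X assume "X \<in> Ob monoids_over"
  then show "is_iso monoids_over (FOb id_func X) (FOb (comp_func (semidirect_func pr A) (ker_func A)) X)
      (decomposition X)"
    by (elim Ob_monoids_overE)
      (simp add: id_func_def comp_func_def semidirect_func_def ker_func_def decomposition_iso)
next
  fix X Y f assume XY: "X \<in> Ob monoids_over" "Y \<in> Ob monoids_over" "f \<in> Mor monoids_over X Y"
  obtain B \<phi> i where X: "X = ((B, \<phi>), fibre_sum pr B \<phi> i, i)" "split_extension K lam A B \<phi> i"
    using XY(1) by (rule Ob_monoids_overE)
  obtain B' \<phi>' i' where Y: "Y = ((B', \<phi>'), fibre_sum pr B' \<phi>' i', i')" "split_extension K lam A B' \<phi>' i'"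
    using XY(2) by (rule Ob_monoids_overE)
  interpret X: split_extension K lam A B \<phi> i by fact
  interpret Y: split_extension K lam A B' \<phi>' i' by fact
  have f: "diff_algebra_hom K lam B B' f" "b \<in> carrier B \<Longrightarrow> \<phi>' (f b) = \<phi> b"
    "x \<in> carrier A \<Longrightarrow> f (i x) = i' x" for b x
    using XY by (simp_all add: X Y Mor_monoids_over)
  interpret f: diff_algebra_hom K lam B B' f by fact
  show "Cmp monoids_over (FOb id_func X) (FOb id_func Y)
        (FOb (comp_func (semidirect_func pr A) (ker_func A)) Y) (decomposition Y) (FMor id_func X Y f) =
      Cmp monoids_over (FOb id_func X) (FOb (comp_func (semidirect_func pr A) (ker_func A)) X)
        (FOb (comp_func (semidirect_func pr A) (ker_func A)) Y)
        (FMor (comp_func (semidirect_func pr A) (ker_func A)) X Y f) (decomposition X)"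
    by (auto simp: id_func_def comp_func_def semidirect_func_def ker_func_def X(1) Y(1)
        X.ker_bimod_simps decomposition_def compose_def fun_eq_iff f.hom_minus f(2,3))
qed

section \<open>The natural isomorphism from the kernel of a semidirect product to the original
  bimodule\<close>

definition kernel_projection :: "('k, 'u) dbimod \<Rightarrow> 'u \<Rightarrow> 'u" where
  "kernel_projection V = (\<lambda>z\<in>carrier (ker_bimod A (semidirect_monoid pr A V)). snd (unpair pr z))"

lemma ker_semidirect_simps:
  "carrier (ker_bimod A (semidirect_monoid pr A V)) = {pr (\<zero>\<^bsub>A\<^esub>, v) |v. v \<in> carrier V}"
  "add (ker_bimod A (semidirect_monoid pr A V)) = add (semidirect pr A V)"
  "smult (ker_bimod A (semidirect_monoid pr A V)) = smult (semidirect pr A V)"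
  "x \<in> carrier A \<Longrightarrow> lact (ker_bimod A (semidirect_monoid pr A V)) x z =
    pr (x, \<zero>\<^bsub>V\<^esub>) \<otimes>\<^bsub>semidirect pr A V\<^esub> z"
  "x \<in> carrier A \<Longrightarrow> ract (ker_bimod A (semidirect_monoid pr A V)) z x =
    z \<otimes>\<^bsub>semidirect pr A V\<^esub> pr (x, \<zero>\<^bsub>V\<^esub>)"
  "bder (ker_bimod A (semidirect_monoid pr A V)) = der (semidirect pr A V)"
  by (auto simp: ker_bimod_def semidirect_monoid_def semidirect_over_def Let_def elim!: semidirectE)

text \<open>The kernel consists of encoded pairs \<open>(0, v)\<close>, so in general it is a copy
  of \<open>V\<close> rather than \<open>V\<close> itself. Its actions through the section are those
  of \<open>V\<close>, since \<open>(x, 0) (0, v) = (0, x v)\<close> and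
  \<open>(0, v) (x, 0) = (0, v x)\<close>.\<close>

lemma kernel_projection_iso:
  assumes V: "diff_bimodule K lam A V"
  shows "is_iso (Bimod K lam A) (ker_bimod A (semidirect_monoid pr A V)) V (kernel_projection V)"
proof -
  interpret V: diff_bimodule K lam A V by fact
  let ?W = "ker_bimod A (semidirect_monoid pr A V)"
  have W: "diff_bimodule K lam A ?W"
    unfolding semidirect_monoid_eq[OF inj_pr lam_closed V]
    by (rule split_extension.ker_bimod_diff_bimodule[OF
        semidirect_split_extension[OF inj_pr lam_closed V] lam_closed])
  let ?g = "\<lambda>v\<in>carrier V. pr (\<zero>\<^bsub>A\<^esub>, v)"
  have kp: "kernel_projection V (pr (\<zero>\<^bsub>A\<^esub>, v)) = v" if "v \<in> carrier V" for v
    using that by (simp add: kernel_projection_def ker_semidirect_simps)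
  have f: "diff_bimodule_hom K lam A ?W V (kernel_projection V)"
  proof (rule diff_bimodule_homI[OF W V], goal_cases)
    case 1 show ?case by (simp add: kernel_projection_def)
  next
    case (5 x z)
    then obtain v where "z = pr (\<zero>\<^bsub>A\<^esub>, v)" "v \<in> carrier V"
      by (auto simp: ker_semidirect_simps)
    with 5(1) show ?case by (simp add: ker_semidirect_simps kp)
  next
    case (6 x z)
    then obtain v where "z = pr (\<zero>\<^bsub>A\<^esub>, v)" "v \<in> carrier V"
      by (auto simp: ker_semidirect_simps)
    with 6(1) show ?case by (simp add: ker_semidirect_simps kp)
  qed (auto simp: ker_semidirect_simps kp)
  have g: "diff_bimodule_hom K lam A V ?W ?g"
    by (rule diff_bimodule_hom_inverse[OF f]) (auto simp: kernel_projection_def ker_semidirect_simps)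
  have "compose (carrier ?W) ?g (kernel_projection V) = (\<lambda>v\<in>carrier ?W. v)"
    "compose (carrier V) (kernel_projection V) ?g = (\<lambda>v\<in>carrier V. v)"
    by (auto simp: compose_def fun_eq_iff kernel_projection_def ker_semidirect_simps)
  with f g show ?thesis
    by (auto simp: is_iso_def Bimod_def)
qed

lemma kernel_projection_natural:
  "natural_iso (Bimod K lam A) (Bimod K lam A) (comp_func (ker_func A) (semidirect_func pr A)) id_func kernel_projection"
  unfolding natural_iso_def
proof (intro conjI ballI)
  fix V assume "V \<in> Ob (Bimod K lam A)"
  then show "is_iso (Bimod K lam A) (FOb (comp_func (ker_func A) (semidirect_func pr A)) V) (FOb id_func V)
      (kernel_projection V)"
    using kernel_projection_iso[of V]
    by (simp add: id_func_def comp_func_def semidirect_func_def ker_func_def) (simp add: Bimod_def)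
next
  fix V W f assume VW: "V \<in> Ob (Bimod K lam A)" "W \<in> Ob (Bimod K lam A)" "f \<in> Mor (Bimod K lam A) V W"
  then interpret f: diff_bimodule_hom K lam A V W f by (simp add: Bimod_def)
  show "Cmp (Bimod K lam A) (FOb (comp_func (ker_func A) (semidirect_func pr A)) V)
        (FOb (comp_func (ker_func A) (semidirect_func pr A)) W) (FOb id_func W) (kernel_projection W)
        (FMor (comp_func (ker_func A) (semidirect_func pr A)) V W f) =
      Cmp (Bimod K lam A) (FOb (comp_func (ker_func A) (semidirect_func pr A)) V) (FOb id_func V)
        (FOb id_func W) (FMor id_func V W f) (kernel_projection V)"
    by (auto simp: id_func_def comp_func_def semidirect_func_def ker_func_def Bimod_def
        kernel_projection_def compose_def fun_eq_iff ker_semidirect_simps)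
qed

end

theorem theorem2p8:
  fixes K :: "('k, 'r) ring_scheme" and lam :: 'k
    and pr :: "'u \<times> 'u \<Rightarrow> 'u" and A :: "('k, 'u) dalg"
  assumes "field K"
    and char_zero: "\<And>n::nat. n > 0 \<Longrightarrow> [n] \<cdot>\<^bsub>K\<^esub> \<one>\<^bsub>K\<^esub> \<noteq> \<zero>\<^bsub>K\<^esub>"
    and "lam \<in> carrier K"
    and "inj pr"
    and "diff_algebra K lam A"
  shows "equivalence_of_categories
    (monoids (slice (DA K lam) A) (slice_products pr A))
    (Bimod K lam A)
    (ker_func A)
    (semidirect_func pr A)"
proof -
  interpret diff_slice K lam A pr
    using assms by (simp add: diff_slice_def diff_slice_axioms_def)
  show ?thesis
    unfolding equivalence_of_categories_def
    using ker_func_is_functor semidirect_func_is_functor decomposition_natural kernel_projection_natural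
    by blast
qed

end
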